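(* Let $M$ be an $F$-structure manifold of degree $K$. The distribution $D_m$ is integrable if and only if $$N_l(mX,mY)=0\quad\text{for all vector fields }X,Y\text{ on }M,$$ or, equivalently, if and only if $l[mX,mY]=0$ for all vector fields $X,Y$ on $M$.
   Context: An $F$-structure manifold of degree $K$ is a smooth $n$-dimensional manifold $M$ with a nonzero smooth $(1,1)$-tensor field $F$ of constant rank $r$ satisfying $\alpha F^{K+1}+\beta F^{K}+F=0$, where $K\ge 3$ is an integer and $\alpha,\beta$ are real or complex numbers (polynomials in $F$ with complex coefficients are regarded as endomorphisms of the complexified tangent bundle). Put $l=-(\alpha F^{K}+\beta F^{K-1})$ and $m=I+\alpha F^{K}+\beta F^{K-1}$; $D_l=\mathrm{Im}\,l$ and $D_m=\mathrm{Im}\,m$ are complementary distributions of dimensions $r$ and $n-r$. For a $(1,1)$-tensor field $T$, the Nijenhuis tensor is $N_T(X,Y)=[TX,TY]-T[TX,Y]-T[X,TY]+T^2[X,Y]$. A distribution $D$ is integrable if through each point of $M$ there is an integral manifold of $D$ (equivalently, by Frobenius, $D$ is involutive). *)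

theory Defs
  imports "HOL-Analysis.Analysis"
begin

section \<open>Smooth maps\<close>

text \<open>For open \<open>U\<close> in a finite-dimensional space this is the usual class \<open>C^k\<close>.\<close>

primrec Ck_on ::
  "nat \<Rightarrow> 'a::real_normed_vector set \<Rightarrow> ('a \<Rightarrow> 'b::real_normed_vector) \<Rightarrow> bool" where
  "Ck_on 0 U f \<longleftrightarrow> continuous_on U f"
| "Ck_on (Suc k) U f \<longleftrightarrow>
     (\<forall>x\<in>U. f differentiable (at x)) \<and> (\<forall>v. Ck_on k U (\<lambda>x. frechet_derivative f (at x) v))"

text \<open>
  As usual, a map on an arbitrary subset \<open>S\<close> is smooth if it extends locally to a smooth map on an
  open set. For open \<open>S\<close> this is ordinary smoothness; for \<open>S\<close> relatively open in a
  linear subspace \<open>E\<close> it is smoothness with respect to linear coordinates on \<open>E\<close>.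
\<close>

definition smooth_on :: "'a::real_normed_vector set \<Rightarrow> ('a \<Rightarrow> 'b::real_normed_vector) \<Rightarrow> bool" where
  "smooth_on S f \<longleftrightarrow>
     (\<forall>x\<in>S. \<exists>W g. open W \<and> x \<in> W \<and> (\<forall>k. Ck_on k W g) \<and> (\<forall>y\<in>S \<inter> W. f y = g y))"


section \<open>Smooth manifolds\<close>

text \<open>
  A chart is a pair of its domain and its coordinate map; the values of the coordinate map
  outside the domain are irrelevant.

  Charts take values in a linear subspace \<open>E\<close> of \<open>real^'n\<close>, and the dimension of the manifold is
  \<open>dim E\<close>. The manifold \<open>M\<close> itself has \<open>E = UNIV\<close> (dimension \<open>CARD('n)\<close>). General \<open>E\<close> is
  needed because the dimension of an integral manifold is not a type, and may be \<open>0\<close>.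
\<close>

type_synonym ('m, 'n) chart = "'m set \<times> ('m \<Rightarrow> real^'n)"

definition transition :: "('m, 'n) chart \<Rightarrow> ('m, 'n) chart \<Rightarrow> real^'n \<Rightarrow> real^'n" where
  "transition c d = snd d \<circ> inv_into (fst c) (snd c)"

definition smooth_manifold ::
  "(real^'n) set \<Rightarrow> 'm topology \<Rightarrow> ('m, 'n::finite) chart set \<Rightarrow> bool" where
  "smooth_manifold E M \<A> \<longleftrightarrow>
     subspace E \<and> Hausdorff_space M \<and> second_countable M \<and>
     (\<Union>c\<in>\<A>. fst c) = topspace M \<and>
     (\<forall>(U, \<phi>)\<in>\<A>.
        openin M U \<and> openin (top_of_set E) (\<phi> ` U) \<and>
        homeomorphic_map (subtopology M U) (top_of_set (\<phi> ` U)) \<phi>) \<and>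
     (\<forall>c\<in>\<A>. \<forall>d\<in>\<A>. smooth_on (snd c ` (fst c \<inter> fst d)) (transition c d))"


section \<open>Vector fields and tensor fields\<close>

text \<open>
  Tangent vectors and tensors are given by their components in each chart of the atlas, subject
  to the transformation law under changes of charts. Components with respect to a chart are
  only meaningful at points of its domain.
\<close>

definition vector_field ::
  "('m, 'n::finite) chart set \<Rightarrow> (('m, 'n) chart \<Rightarrow> 'm \<Rightarrow> real^'n) \<Rightarrow> bool" where
  "vector_field \<A> X \<longleftrightarrow>
     (\<forall>c\<in>\<A>. smooth_on (snd c ` fst c) (X c \<circ> inv_into (fst c) (snd c))) \<and>
     (\<forall>c\<in>\<A>. \<forall>d\<in>\<A>. \<forall>p\<in>fst c \<inter> fst d.
        X d p = jacobian (transition c d) (at (snd c p)) *v X c p)"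

definition tensor_field_1_1 ::
  "('m, 'n::finite) chart set \<Rightarrow> (('m, 'n) chart \<Rightarrow> 'm \<Rightarrow> real^'n^'n) \<Rightarrow> bool" where
  "tensor_field_1_1 \<A> T \<longleftrightarrow>
     (\<forall>c\<in>\<A>. smooth_on (snd c ` fst c) (T c \<circ> inv_into (fst c) (snd c))) \<and>
     (\<forall>c\<in>\<A>. \<forall>d\<in>\<A>. \<forall>p\<in>fst c \<inter> fst d.
        T d p ** jacobian (transition c d) (at (snd c p)) =
        jacobian (transition c d) (at (snd c p)) ** T c p)"

text \<open>
  The fibres of the complexified tangent bundle are, in a chart, \<open>complex^'n\<close>. The bracket is the
  complex bilinear extension of the Lie bracket; in coordinates,
  \<open>[Z, W] = \<Sum>j. Z^j \<partial>_j W - W^j \<partial>_j Z\<close>.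
\<close>

definition complexify_vec :: "real^'n \<Rightarrow> complex^'n" where
  "complexify_vec v = (\<chi> i. complex_of_real (v $ i))"

definition complexify_field ::
  "(('m, 'n) chart \<Rightarrow> 'm \<Rightarrow> real^'n) \<Rightarrow> ('m, 'n) chart \<Rightarrow> 'm \<Rightarrow> complex^'n" where
  "complexify_field X = (\<lambda>c p. complexify_vec (X c p))"

definition complexify_subspace :: "(real^'n) set \<Rightarrow> (complex^'n) set" where
  "complexify_subspace R =
     {complexify_vec u + \<i> *s complexify_vec v | u v. u \<in> R \<and> v \<in> R}"

definition lie_bracket ::
  "(('m, 'n::finite) chart \<Rightarrow> 'm \<Rightarrow> complex^'n) \<Rightarrow> (('m, 'n) chart \<Rightarrow> 'm \<Rightarrow> complex^'n) \<Rightarrow>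
   ('m, 'n) chart \<Rightarrow> 'm \<Rightarrow> complex^'n" where
  "lie_bracket Z W = (\<lambda>c p.
     let \<psi> = inv_into (fst c) (snd c); x = snd c p in
     (\<Sum>j\<in>UNIV. Z c p $ j *s frechet_derivative (W c \<circ> \<psi>) (at x) (axis j 1)
              - W c p $ j *s frechet_derivative (Z c \<circ> \<psi>) (at x) (axis j 1)))"

definition apply_tensor ::
  "(('m, 'n::finite) chart \<Rightarrow> 'm \<Rightarrow> complex^'n^'n) \<Rightarrow> (('m, 'n) chart \<Rightarrow> 'm \<Rightarrow> complex^'n) \<Rightarrow>
   ('m, 'n) chart \<Rightarrow> 'm \<Rightarrow> complex^'n" where
  "apply_tensor T Z = (\<lambda>c p. T c p *v Z c p)"

definition nijenhuis ::
  "(('m, 'n::finite) chart \<Rightarrow> 'm \<Rightarrow> complex^'n^'n) \<Rightarrow>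
   (('m, 'n) chart \<Rightarrow> 'm \<Rightarrow> complex^'n) \<Rightarrow> (('m, 'n) chart \<Rightarrow> 'm \<Rightarrow> complex^'n) \<Rightarrow>
   ('m, 'n) chart \<Rightarrow> 'm \<Rightarrow> complex^'n" where
  "nijenhuis T Z W = (\<lambda>c p.
     lie_bracket (apply_tensor T Z) (apply_tensor T W) c p
     - apply_tensor T (lie_bracket (apply_tensor T Z) W) c p
     - apply_tensor T (lie_bracket Z (apply_tensor T W)) c p
     + apply_tensor T (apply_tensor T (lie_bracket Z W)) c p)"

definition vanishes_on ::
  "('m, 'n) chart set \<Rightarrow> (('m, 'n::finite) chart \<Rightarrow> 'm \<Rightarrow> complex^'n) \<Rightarrow> bool" where
  "vanishes_on \<A> Z \<longleftrightarrow> (\<forall>c\<in>\<A>. \<forall>p\<in>fst c. Z c p = 0)"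


section \<open>Integrability of distributions\<close>

text \<open>
  An integral manifold of a distribution \<open>D\<close> is an immersed submanifold \<open>N\<close> of \<open>M\<close>
  (a subset with its own topology and atlas for which the inclusion is an immersion) whose tangent
  space at every point \<open>q\<close> is \<open>D\<close>. As \<open>D\<close> is a family of subspaces of the
  complexified tangent spaces, the complexification of \<open>T_q N\<close> is meant; for the
  complexification of a real distribution this says that \<open>T_q N\<close> is the real distribution at \<open>q\<close>.
  On \<open>E\<close> the derivative within \<open>snd d ` (fst d \<inter> fst c)\<close> is uniquely determined, because
  that set is relatively open in \<open>E\<close>; values of \<open>f'\<close> outside \<open>E\<close> are not used.
\<close>

definition integral_manifold ::
  "'m topology \<Rightarrow> ('m, 'n::finite) chart set \<Rightarrow> (('m, 'n) chart \<Rightarrow> 'm \<Rightarrow> (complex^'n) set) \<Rightarrow>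
   (real^'n) set \<Rightarrow> 'm topology \<Rightarrow> ('m, 'n) chart set \<Rightarrow> bool" where
  "integral_manifold M \<A> D E N \<B> \<longleftrightarrow>
     smooth_manifold E N \<B> \<and>
     topspace N \<subseteq> topspace M \<and> continuous_map N M id \<and>
     (\<forall>d\<in>\<B>. \<forall>c\<in>\<A>.
        smooth_on (snd d ` (fst d \<inter> fst c)) (transition d c) \<and>
        (\<forall>q\<in>fst d \<inter> fst c. \<exists>f'.
           (transition d c has_derivative f') (at (snd d q) within snd d ` (fst d \<inter> fst c)) \<and>
           inj_on f' E \<and>
           complexify_subspace (f' ` E) = D c q))"

definition integrable_distribution ::
  "'m topology \<Rightarrow> ('m, 'n::finite) chart set \<Rightarrow>
   (('m, 'n) chart \<Rightarrow> 'm \<Rightarrow> (complex^'n) set) \<Rightarrow> bool" where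
  "integrable_distribution M \<A> D \<longleftrightarrow>
     (\<forall>p\<in>topspace M. \<exists>E N \<B>. integral_manifold M \<A> D E N \<B> \<and> p \<in> topspace N)"


section \<open>\<open>F\<close>-structures\<close>

definition mat_power :: "'a::semiring_1^'n^'n \<Rightarrow> nat \<Rightarrow> 'a^'n^'n" where
  "mat_power A k = (((**) A) ^^ k) (mat 1)"

definition tensor_power ::
  "(('m, 'n::finite) chart \<Rightarrow> 'm \<Rightarrow> real^'n^'n) \<Rightarrow> nat \<Rightarrow> ('m, 'n) chart \<Rightarrow> 'm \<Rightarrow> complex^'n^'n" where
  "tensor_power F k = (\<lambda>c p. mat_power (map_matrix complex_of_real (F c p)) k)"

text \<open>The matrix \<open>mat a ** A\<close> is the scalar multiple \<open>a A\<close>.\<close>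

definition F_structure_manifold ::
  "'m topology \<Rightarrow> ('m, 'n::finite) chart set \<Rightarrow> (('m, 'n) chart \<Rightarrow> 'm \<Rightarrow> real^'n^'n) \<Rightarrow>
   nat \<Rightarrow> nat \<Rightarrow> complex \<Rightarrow> complex \<Rightarrow> bool" where
  "F_structure_manifold M \<A> F r K \<alpha> \<beta> \<longleftrightarrow>
     smooth_manifold UNIV M \<A> \<and>
     tensor_field_1_1 \<A> F \<and>
     (\<exists>c\<in>\<A>. \<exists>p\<in>fst c. F c p \<noteq> 0) \<and>
     (\<forall>c\<in>\<A>. \<forall>p\<in>fst c. rank (F c p) = r) \<and>
     3 \<le> K \<and>
     (\<forall>c\<in>\<A>. \<forall>p\<in>fst c.
        mat \<alpha> ** tensor_power F (K + 1) c p + mat \<beta> ** tensor_power F K c p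
        + tensor_power F 1 c p = 0)"

definition proj_l ::
  "(('m, 'n::finite) chart \<Rightarrow> 'm \<Rightarrow> real^'n^'n) \<Rightarrow> nat \<Rightarrow> complex \<Rightarrow> complex \<Rightarrow>
   ('m, 'n) chart \<Rightarrow> 'm \<Rightarrow> complex^'n^'n" where
  "proj_l F K \<alpha> \<beta> = (\<lambda>c p.
     - (mat \<alpha> ** tensor_power F K c p + mat \<beta> ** tensor_power F (K - 1) c p))"

definition proj_m ::
  "(('m, 'n::finite) chart \<Rightarrow> 'm \<Rightarrow> real^'n^'n) \<Rightarrow> nat \<Rightarrow> complex \<Rightarrow> complex \<Rightarrow>
   ('m, 'n) chart \<Rightarrow> 'm \<Rightarrow> complex^'n^'n" where
  "proj_m F K \<alpha> \<beta> = (\<lambda>c p.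
     mat 1 + mat \<alpha> ** tensor_power F K c p + mat \<beta> ** tensor_power F (K - 1) c p)"

definition distribution_of ::
  "(('m, 'n::finite) chart \<Rightarrow> 'm \<Rightarrow> complex^'n^'n) \<Rightarrow>
   ('m, 'n) chart \<Rightarrow> 'm \<Rightarrow> (complex^'n) set" where
  "distribution_of T = (\<lambda>c p. range ((*v) (T c p)))"

end

theory Submission
  imports Defs
begin

text \<open>
  The tensor \<open>l\<close> is the complexification of a smooth field \<open>L\<close> of real projections with
  \<open>ker L = D\<^sub>m\<close>. Differentiating \<open>L Z = 0\<close> gives, for sections \<open>Z\<close>, \<open>W\<close> of \<open>ker L\<close>,
  \<open>L[Z, W] = (D\<^sub>W L) Z - (D\<^sub>Z L) W\<close>, which depends only on the values of \<open>Z\<close> and \<open>W\<close> at the point; so the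
  bracket condition says that \<open>(u, v) \<mapsto> (D\<^sub>u L) v\<close> is symmetric on \<open>ker L\<close>. On an integral manifold
  this is the symmetry of second derivatives. Conversely, let \<open>m\<^sub>0\<close> be the projection onto \<open>ker L\<close> at a
  point \<open>x\<^sub>0\<close>, and near \<open>x\<^sub>0\<close> let \<open>B(x)\<close> be the map with image \<open>ker L(x)\<close> and \<open>m\<^sub>0 B(x) = m\<^sub>0\<close>. The symmetry is
  exactly the integrability condition of the total differential equation \<open>f'(w) = B(f(w))\<close>, \<open>f(0) = x\<^sub>0\<close>,
  and its solution, restricted to \<open>im m\<^sub>0\<close>, parametrizes the integral manifold through \<open>x\<^sub>0\<close>.
\<close>

section \<open>Calculus of \<open>C^k\<close> maps\<close>

text \<open>The equivalence of the two analytic conditions is algebra: \<open>l m = 0\<close> and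
  \<open>l l = l\<close> collapse \<open>N_l(mX, mY)\<close> to \<open>l[mX, mY]\<close>. Two
  obstacles shape the rest. Both conditions quantify over global vector fields, whereas the symmetry
  of \<open>(u, v) \<mapsto> (D\<^sub>u L) v\<close> concerns vectors at a single point. Every
  tangent vector therefore has to be extended to a global field, which takes a smooth bump function
  and the Hausdorff property of \<open>M\<close>. Moreover, the dimension of an integral manifold is
  a number and not a type. Instead of choosing a basis of the distribution, \<open>B(x)\<close>
  accepts every vector of \<open>real^'n\<close> and annihilates the kernel of
  \<open>m\<^sub>0\<close>. The total differential equation can then be solved on a full ball, where
  ordinary calculus applies, and the subspace \<open>im m\<^sub>0\<close> itself serves as the model
  space of the integral manifold.\<close>

lemma has_derivative_cong_open:
  assumes "open U" "x \<in> U" "\<And>y. y \<in> U \<Longrightarrow> f y = g y"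
  shows "(f has_derivative D) (at x) \<longleftrightarrow> (g has_derivative D) (at x)"
proof
  show "(g has_derivative D) (at x)" if "(f has_derivative D) (at x)"
    by (rule has_derivative_transform_within_open[OF that assms])
  show "(f has_derivative D) (at x)" if "(g has_derivative D) (at x)"
    by (rule has_derivative_transform_within_open[OF that assms(1,2)]) (simp add: assms(3))
qed

lemma frechet_derivative_cong_open:
  assumes "open U" "x \<in> U" "\<And>y. y \<in> U \<Longrightarrow> f y = g y"
  shows "frechet_derivative f (at x) = frechet_derivative g (at x)"
  unfolding frechet_derivative_def using has_derivative_cong_open[of U x f g] assms by simp

lemma differentiable_cong_open:
  assumes "open U" "x \<in> U" "\<And>y. y \<in> U \<Longrightarrow> f y = g y"
  shows "f differentiable at x \<longleftrightarrow> g differentiable at x"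
  unfolding differentiable_def using has_derivative_cong_open[of U x f g] assms by simp

lemma Ck_on_cong:
  assumes "open U" "\<And>y. y \<in> U \<Longrightarrow> f y = g y" "Ck_on k U f"
  shows "Ck_on k U g"
  using assms(2,3)
proof (induction k arbitrary: f g)
  case 0
  then show ?case using continuous_on_cong[of U U f g] by simp
next
  case (Suc k)
  have eq: "frechet_derivative f (at x) v = frechet_derivative g (at x) v" if "x \<in> U" for x v
    using frechet_derivative_cong_open[of U x f g] Suc.prems(1) assms(1) that by simp
  have "Ck_on k U (\<lambda>x. frechet_derivative f (at x) v)" for v
    using Suc.prems(2) by simp
  then have "Ck_on k U (\<lambda>x. frechet_derivative g (at x) v)" for v
    by (rule Suc.IH[rotated]) (rule eq)
  moreover have "g differentiable at x" if "x \<in> U" for x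
    using differentiable_cong_open[of U x f g] Suc.prems assms(1) that by simp
  ultimately show ?case by simp
qed

lemma Ck_on_subset: "Ck_on k U f \<Longrightarrow> V \<subseteq> U \<Longrightarrow> Ck_on k V f"
  by (induction k arbitrary: f) (auto intro: continuous_on_subset)

lemma Ck_on_Suc_imp: "Ck_on (Suc k) U f \<Longrightarrow> Ck_on k U f"
proof (induction k arbitrary: f)
  case 0
  then show ?case
    by (auto intro!: continuous_at_imp_continuous_on differentiable_imp_continuous_within)
next
  case (Suc k)
  show ?case
    unfolding Ck_on.simps(2)[of k]
    using Suc.IH Suc.prems unfolding Ck_on.simps(2)[of "Suc k"] by blast
qed

lemma Ck_on_mono: "Ck_on k U f \<Longrightarrow> j \<le> k \<Longrightarrow> Ck_on j U f"
  by (induction k) (use Ck_on_Suc_imp le_Suc_eq in \<open>blast+\<close>)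

lemma Ck_on_imp_continuous: "Ck_on k U f \<Longrightarrow> continuous_on U f"
  using Ck_on_mono[of k U f 0] by simp

lemma Ck_on_imp_has_derivative:
  "Ck_on (Suc k) U f \<Longrightarrow> x \<in> U \<Longrightarrow> (f has_derivative frechet_derivative f (at x)) (at x)"
  by (simp add: frechet_derivative_works[symmetric])

lemma Ck_on_SucI:
  assumes "open U" "\<And>x. x \<in> U \<Longrightarrow> (f has_derivative D x) (at x)"
    and "\<And>v. Ck_on k U (\<lambda>x. D x v)"
  shows "Ck_on (Suc k) U f"
proof -
  have "Ck_on k U (\<lambda>x. frechet_derivative f (at x) v)" for v
    by (rule Ck_on_cong[OF assms(1) _ assms(3)[of v]])
      (use frechet_derivative_at[OF assms(2)] in auto)
  then show ?thesis
    using assms(2) by (auto simp: differentiable_def)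
qed

lemma Ck_on_const [simp]: "Ck_on k U (\<lambda>x. c)"
  by (induction k arbitrary: c) (auto simp: frechet_derivative_const)

lemma Ck_on_linear:
  assumes "bounded_linear h" "open U" shows "Ck_on k U h"
proof (cases k)
  case 0
  then show ?thesis using assms by (simp add: linear_continuous_on)
next
  case (Suc j)
  have "Ck_on (Suc j) U h"
    by (rule Ck_on_SucI[OF assms(2), where D="\<lambda>_. h"])
      (use assms bounded_linear_imp_has_derivative in auto)
  with Suc show ?thesis by simp
qed

lemma Ck_on_linear_comp:
  assumes "bounded_linear h" "open U" "Ck_on k U f"
  shows "Ck_on k U (\<lambda>x. h (f x))"
  using assms(3)
proof (induction k arbitrary: f)
  case 0
  then show ?case using assms(1) by (simp add: bounded_linear.continuous_on)
next
  case (Suc k)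
  show ?case
  proof (rule Ck_on_SucI[OF assms(2), where D="\<lambda>x v. h (frechet_derivative f (at x) v)"])
    show "((\<lambda>x. h (f x)) has_derivative (\<lambda>v. h (frechet_derivative f (at x) v))) (at x)" if "x \<in> U" for x
      using bounded_linear.has_derivative[OF assms(1) Ck_on_imp_has_derivative[OF Suc.prems that]] .
    show "Ck_on k U (\<lambda>x. h (frechet_derivative f (at x) v))" for v
      using Suc by simp
  qed
qed

lemma Ck_on_add:
  assumes "open U" "Ck_on k U f" "Ck_on k U g"
  shows "Ck_on k U (\<lambda>x. f x + g x)"
  using assms(2,3)
proof (induction k arbitrary: f g)
  case 0
  then show ?case by (simp add: continuous_on_add)
next
  case (Suc k)
  show ?case
  proof (rule Ck_on_SucI[OF assms(1), where
        D="\<lambda>x v. frechet_derivative f (at x) v + frechet_derivative g (at x) v"])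
    show "((\<lambda>x. f x + g x) has_derivative
        (\<lambda>v. frechet_derivative f (at x) v + frechet_derivative g (at x) v)) (at x)" if "x \<in> U" for x
      by (intro has_derivative_add Ck_on_imp_has_derivative[OF Suc.prems(1) that]
          Ck_on_imp_has_derivative[OF Suc.prems(2) that])
  qed (use Suc in auto)
qed

lemma Ck_on_bilinear:
  assumes "bounded_bilinear h" "open U" "Ck_on k U f" "Ck_on k U g"
  shows "Ck_on k U (\<lambda>x. h (f x) (g x))"
  using assms(3,4)
proof (induction k arbitrary: f g)
  case 0
  then show ?case using bounded_bilinear.continuous_on[OF assms(1)] by auto
next
  case (Suc k)
  show ?case
  proof (rule Ck_on_SucI[OF assms(2), where
        D="\<lambda>x v. h (f x) (frechet_derivative g (at x) v) + h (frechet_derivative f (at x) v) (g x)"])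
    show "((\<lambda>x. h (f x) (g x)) has_derivative
        (\<lambda>v. h (f x) (frechet_derivative g (at x) v) + h (frechet_derivative f (at x) v) (g x))) (at x)"
      if "x \<in> U" for x
      by (intro bounded_bilinear.FDERIV[OF assms(1)] Ck_on_imp_has_derivative[OF Suc.prems(1) that]
          Ck_on_imp_has_derivative[OF Suc.prems(2) that])
    show "Ck_on k U (\<lambda>x. h (f x) (frechet_derivative g (at x) v) + h (frechet_derivative f (at x) v) (g x))" for v
      using Suc.prems Ck_on_Suc_imp[OF Suc.prems(1)] Ck_on_Suc_imp[OF Suc.prems(2)]
      by (intro Ck_on_add[OF assms(2)] Suc.IH) auto
  qed
qed

lemma Ck_on_sum:
  assumes "open U" "\<And>i. i \<in> I \<Longrightarrow> Ck_on k U (f i)"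
  shows "Ck_on k U (\<lambda>x. \<Sum>i\<in>I. f i x)"
  using assms(2)
  by (induction I rule: infinite_finite_induct) (auto intro!: Ck_on_add[OF assms(1)])

text \<open>\<open>Ck_on\<close> controls derivatives in fixed directions only. A basis expansion
  turns the derivative in a direction that varies with the point into finitely many fixed directions
  with scalar coefficients.\<close>

lemma linear_basis_expansion:
  fixes h :: "'b::euclidean_space \<Rightarrow> 'c::real_vector"
  assumes "linear h"
  shows "h w = (\<Sum>b\<in>Basis. (w \<bullet> b) *\<^sub>R h b)"
proof -
  have "h w = h (\<Sum>b\<in>Basis. (w \<bullet> b) *\<^sub>R b)" by (simp add: euclidean_representation)
  also have "\<dots> = (\<Sum>b\<in>Basis. (w \<bullet> b) *\<^sub>R h b)"
    by (simp only: linear_sum[OF assms] linear_cmul[OF assms])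
  finally show ?thesis .
qed

text \<open>By the chain rule, a directional derivative of the composite is a sum of products of a
  coefficient of the derivative of \<open>f\<close> with a basis derivative of \<open>g\<close>,
  taken at \<open>f x\<close>. The latter is again a composite, with \<open>g\<close> replaced by
  its derivative, so the induction generalizes over \<open>g\<close>.\<close>

lemma Ck_on_compose:
  fixes f :: "'a::real_normed_vector \<Rightarrow> 'b::euclidean_space"
    and g :: "'b \<Rightarrow> 'c::real_normed_vector"
  assumes "open U" "Ck_on k V g" "Ck_on k U f" "f ` U \<subseteq> V"
  shows "Ck_on k U (\<lambda>x. g (f x))"
  using assms(2,3)
proof (induction k arbitrary: g)
  case 0
  then show ?case using continuous_on_compose2[OF _ _ assms(4)] by simp
next
  case (Suc k)
  have fk: "Ck_on k U f" using Suc.prems Ck_on_Suc_imp by blast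
  show ?case
  proof (rule Ck_on_SucI[OF assms(1), where D="\<lambda>x v. \<Sum>b\<in>Basis.
        (frechet_derivative f (at x) v \<bullet> b) *\<^sub>R frechet_derivative g (at (f x)) b"])
    show "((\<lambda>x. g (f x)) has_derivative (\<lambda>v. \<Sum>b\<in>Basis.
        (frechet_derivative f (at x) v \<bullet> b) *\<^sub>R frechet_derivative g (at (f x)) b)) (at x)"
      if "x \<in> U" for x
    proof -
      have g: "(g has_derivative frechet_derivative g (at (f x))) (at (f x))"
        by (rule Ck_on_imp_has_derivative[OF Suc.prems(1)]) (use that assms(4) in auto)
      have "((\<lambda>x. g (f x)) has_derivative
          (\<lambda>v. frechet_derivative g (at (f x)) (frechet_derivative f (at x) v))) (at x)"
        using diff_chain_at[OF Ck_on_imp_has_derivative[OF Suc.prems(2) that] g] by (simp add: o_def)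
      moreover have "(\<lambda>v. frechet_derivative g (at (f x)) (frechet_derivative f (at x) v)) = (\<lambda>v.
          \<Sum>b\<in>Basis. (frechet_derivative f (at x) v \<bullet> b) *\<^sub>R frechet_derivative g (at (f x)) b)"
        by (intro ext linear_basis_expansion has_derivative_linear[OF g])
      ultimately show ?thesis by simp
    qed
    show "Ck_on k U (\<lambda>x. \<Sum>b\<in>Basis.
        (frechet_derivative f (at x) v \<bullet> b) *\<^sub>R frechet_derivative g (at (f x)) b)" for v
    proof -
      have f: "Ck_on k U (\<lambda>x. frechet_derivative f (at x) v)"
        using Suc.prems(2) by simp
      have g: "Ck_on k V (\<lambda>y. frechet_derivative g (at y) b)" for b
        using Suc.prems(1) by simp
      have fb: "Ck_on k U (\<lambda>x. frechet_derivative f (at x) v \<bullet> b)" for b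
        using Ck_on_linear_comp[OF bounded_linear_inner_left assms(1) f] .
      have gb: "Ck_on k U (\<lambda>x. frechet_derivative g (at (f x)) b)" for b
        using Suc.IH[OF g fk] .
      show ?thesis
        using Ck_on_sum[OF assms(1) Ck_on_bilinear[OF bounded_bilinear_scaleR assms(1) fb gb]] .
    qed
  qed
qed

lemma Ck_on_local:
  assumes "\<And>x. x \<in> U \<Longrightarrow> \<exists>W g. open W \<and> x \<in> W \<and> Ck_on k W g \<and> (\<forall>y\<in>W. f y = g y)"
  shows "Ck_on k U f"
proof -
  \<comment> \<open>Replacing the local model \<open>g\<close> by \<open>f\<close> itself lets the
    same neighbourhood serve for the derivatives of \<open>f\<close> in the induction.\<close>
  have "\<exists>W. open W \<and> x \<in> W \<and> Ck_on k W f" if "x \<in> U" for x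
  proof -
    obtain W g where W: "open W" "x \<in> W" "Ck_on k W g" "\<forall>y\<in>W. f y = g y"
      using assms[OF \<open>x \<in> U\<close>] by blast
    then have "Ck_on k W f" by (intro Ck_on_cong[OF W(1) _ W(3)]) simp
    with W show ?thesis by blast
  qed
  then show ?thesis
  proof (induction k arbitrary: f)
    case 0
    show ?case
      unfolding Ck_on.simps
    proof (rule continuous_at_imp_continuous_on, rule ballI)
      fix x assume "x \<in> U"
      then obtain W where "open W" "x \<in> W" "continuous_on W f" using 0 by auto
      then show "isCont f x" using continuous_on_eq_continuous_at by blast
    qed
  next
    case (Suc k)
    show ?case
      unfolding Ck_on.simps
    proof (intro conjI ballI allI)
      show "f differentiable at x" if "x \<in> U" for x
        using Suc.prems[OF that] by auto
      show "Ck_on k U (\<lambda>x. frechet_derivative f (at x) v)" for v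
      proof (rule Suc.IH)
        fix x assume "x \<in> U"
        then obtain W where "open W" "x \<in> W" "Ck_on (Suc k) W f" using Suc.prems by blast
        then show "\<exists>W. open W \<and> x \<in> W \<and> Ck_on k W (\<lambda>x. frechet_derivative f (at x) v)" by auto
      qed
    qed
  qed
qed

lemma smooth_on_open_iff:
  assumes "open S" shows "smooth_on S f \<longleftrightarrow> (\<forall>k. Ck_on k S f)"
proof
  assume sm: "smooth_on S f"
  show "\<forall>k. Ck_on k S f"
  proof (intro allI Ck_on_local)
    fix k x assume "x \<in> S"
    then obtain W g where W: "open W" "x \<in> W" "\<forall>k. Ck_on k W g" "\<forall>y\<in>S \<inter> W. f y = g y"
      using sm unfolding smooth_on_def by metis
    have "Ck_on k (S \<inter> W) g" using W(3) Ck_on_subset by (metis inf_le2)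
    then show "\<exists>W g. open W \<and> x \<in> W \<and> Ck_on k W g \<and> (\<forall>y\<in>W. f y = g y)"
      using W assms \<open>x \<in> S\<close> by (intro exI[of _ "S \<inter> W"] exI[of _ g]) auto
  qed
next
  assume "\<forall>k. Ck_on k S f"
  then show "smooth_on S f"
    unfolding smooth_on_def using assms by blast
qed

section \<open>Smoothness of determinants and matrix inverses\<close>

lemma Ck_on_prod:
  fixes f :: "'i \<Rightarrow> 'a::real_normed_vector \<Rightarrow> real"
  assumes "open U" "\<And>i. i \<in> I \<Longrightarrow> Ck_on k U (f i)"
  shows "Ck_on k U (\<lambda>x. \<Prod>i\<in>I. f i x)"
  using assms(2)
  by (induction I rule: infinite_finite_induct)
    (auto intro!: Ck_on_bilinear[OF bounded_bilinear_mult assms(1)])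

text \<open>The derivative of the reciprocal is a product of reciprocals, so the induction feeds on
  its own hypothesis.\<close>

lemma Ck_on_inverse: "Ck_on k {x::real. x \<noteq> 0} inverse"
proof (induction k)
  case 0
  then show ?case by (auto intro!: continuous_intros)
next
  case (Suc k)
  have "open {x::real. x \<noteq> 0}" by (simp add: open_Collect_neq)
  then show ?case
  proof (rule Ck_on_SucI[where D="\<lambda>x v. - (inverse x * v * inverse x)"])
    show "(inverse has_derivative (\<lambda>v. - (inverse x * v * inverse x))) (at x)"
      if "x \<in> {x. x \<noteq> 0}" for x :: real
      using that by (auto intro: has_derivative_inverse')
    have "Ck_on k {x::real. x \<noteq> 0} (\<lambda>x. (inverse x * v) * inverse x)" for v
      by (intro Ck_on_bilinear[OF bounded_bilinear_mult] Suc Ck_on_const) (simp_all add: open_Collect_neq)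
    from Ck_on_linear_comp[OF bounded_linear_minus[OF bounded_linear_ident] _ this]
    show "Ck_on k {x::real. x \<noteq> 0} (\<lambda>x. - (inverse x * v * inverse x))" for v
      by (simp add: open_Collect_neq)
  qed
qed

lemma bounded_linear_vec_nth2: "bounded_linear (\<lambda>A::real^'n^'m. A $ i $ j)"
  using bounded_linear_compose[OF bounded_linear_vec_nth bounded_linear_vec_nth] by blast

lemma bounded_bilinear_matrix_vector: "bounded_bilinear ((*v) :: real^'n^'m \<Rightarrow> _)"
  by (rule bilinear_conv_bounded_bilinear[THEN iffD1])
    (auto simp: bilinear_def linear_iff vec_eq_iff matrix_vector_mult_def
      algebra_simps sum.distrib sum_distrib_left)

lemma bounded_bilinear_matrix_matrix: "bounded_bilinear ((**) :: real^'n^'m \<Rightarrow> real^'k^'n \<Rightarrow> _)"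
  by (rule bilinear_conv_bounded_bilinear[THEN iffD1])
    (auto simp: bilinear_def linear_iff vec_eq_iff matrix_matrix_mult_def
      algebra_simps sum.distrib sum_distrib_left)

lemmas matrix_add_left = bounded_bilinear.add_left[OF bounded_bilinear_matrix_matrix]
  and matrix_add_right = bounded_bilinear.add_right[OF bounded_bilinear_matrix_matrix]
  and matrix_diff_left = bounded_bilinear.diff_left[OF bounded_bilinear_matrix_matrix]
  and matrix_diff_right = bounded_bilinear.diff_right[OF bounded_bilinear_matrix_matrix]
  and matrix_minus_left = bounded_bilinear.minus_left[OF bounded_bilinear_matrix_matrix]
  and matrix_minus_right = bounded_bilinear.minus_right[OF bounded_bilinear_matrix_matrix]
  and matrix_scaleR_left = bounded_bilinear.scaleR_left[OF bounded_bilinear_matrix_matrix]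
  and matrix_scaleR_right = bounded_bilinear.scaleR_right[OF bounded_bilinear_matrix_matrix]

lemma Ck_on_vec_lambda:
  fixes f :: "'a::real_normed_vector \<Rightarrow> 'n::finite \<Rightarrow> 'b::euclidean_space"
  assumes "open U" "\<And>i. Ck_on k U (\<lambda>x. f x i)"
  shows "Ck_on k U (\<lambda>x. \<chi> i. f x i)"
proof -
  have "linear (axis i :: 'b \<Rightarrow> 'b^'n)" for i
    by (auto simp: linear_iff axis_def vec_eq_iff)
  then have "Ck_on k U (\<lambda>x. axis i (f x i) :: 'b^'n)" for i
    using Ck_on_linear_comp[OF _ assms] linear_conv_bounded_linear by blast
  then have "Ck_on k U (\<lambda>x. \<Sum>i\<in>UNIV. axis i (f x i) :: 'b^'n)"
    by (rule Ck_on_sum[OF assms(1)])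
  moreover have "(\<Sum>i\<in>UNIV. axis i (f x i)) = (\<chi> i. f x i)" for x
    by (simp add: vec_eq_iff axis_def)
  ultimately show ?thesis by simp
qed

lemma Ck_on_det:
  fixes A :: "'a::real_normed_vector \<Rightarrow> real^'n^'n"
  assumes "open U" "\<And>i j. Ck_on k U (\<lambda>x. A x $ i $ j)"
  shows "Ck_on k U (\<lambda>x. det (A x))"
  unfolding det_def
  by (intro Ck_on_sum Ck_on_bilinear[OF bounded_bilinear_mult] Ck_on_prod assms Ck_on_const)

lemma matrix_inv_both:
  fixes A :: "real^'n^'n"
  assumes "invertible A"
  shows matrix_inv_left: "matrix_inv A ** A = mat 1" and matrix_inv_right: "A ** matrix_inv A = mat 1"
proof -
  have "\<exists>B. A ** B = mat 1 \<and> B ** A = mat 1" using assms invertible_def by blast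
  then have "A ** matrix_inv A = mat 1 \<and> matrix_inv A ** A = mat 1"
    unfolding matrix_inv_def by (rule someI_ex)
  then show "matrix_inv A ** A = mat 1" "A ** matrix_inv A = mat 1" by auto
qed

text \<open>Column \<open>l\<close> of the inverse solves \<open>A y = axis l 1\<close>. Cramer's
  rule therefore writes every entry of the inverse as a quotient of determinants, and determinants
  are polynomials in the entries.\<close>

lemma Ck_on_matrix_inv:
  fixes A :: "'a::real_normed_vector \<Rightarrow> real^'n^'n"
  assumes "open U" "Ck_on k U A" "\<And>x. x \<in> U \<Longrightarrow> det (A x) \<noteq> 0"
  shows "Ck_on k U (\<lambda>x. matrix_inv (A x))"
proof -
  have A: "Ck_on k U (\<lambda>x. A x $ i $ j)" for i j
    by (rule Ck_on_linear_comp[OF bounded_linear_vec_nth2 assms(1,2)])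
  define B where "B x = (\<chi> k l. det (\<chi> i j. if j = k then axis l 1 $ i else A x $ i $ j) * inverse (det (A x)))"
    for x
  have CB: "Ck_on k U B"
    unfolding B_def
  proof (intro Ck_on_vec_lambda Ck_on_bilinear[OF bounded_bilinear_mult] Ck_on_det assms(1))
    show "Ck_on k U (\<lambda>x. (\<chi> i j. if j = p then axis q 1 $ i else A x $ i $ j) $ i $ j)" for p q i j
      using A by (cases "j = p") simp_all
    show "Ck_on k U (\<lambda>x. inverse (det (A x)))"
      by (rule Ck_on_compose[OF assms(1) Ck_on_inverse Ck_on_det]) (simp_all add: A assms(1) image_subset_iff assms(3))
  qed
  have eq: "B x = matrix_inv (A x)" if "x \<in> U" for x
  proof -
    have d: "det (A x) \<noteq> 0" using assms(3) that .
    then have inv: "invertible (A x)" by (simp add: invertible_det_nz)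
    have "A x *v column l (B x) = axis l 1" for l
    proof -
      have "column l (B x) = (\<chi> k. det (\<chi> i j. if j = k then axis l 1 $ i else A x $ i $ j) / det (A x))"
        by (simp add: B_def column_def vec_eq_iff divide_inverse)
      then show ?thesis by (rule cramer[OF d, THEN iffD2])
    qed
    then have "(\<Sum>k\<in>UNIV. A x $ i $ k * B x $ k $ l) = (if i = l then 1 else 0)" for i l
      by (simp add: vec_eq_iff matrix_vector_mult_def column_def axis_def)
    then have AB: "A x ** B x = mat 1"
      by (simp add: matrix_matrix_mult_def mat_def)
    have "matrix_inv (A x) = matrix_inv (A x) ** (A x ** B x)"
      unfolding AB by (rule matrix_mul_rid[symmetric])
    also have "\<dots> = B x" unfolding matrix_mul_assoc matrix_inv_left[OF inv] by (rule matrix_mul_lid)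
    finally show ?thesis by (rule sym)
  qed
  show ?thesis by (rule Ck_on_cong[OF assms(1) eq CB])
qed

section \<open>Second derivatives and Picard iteration\<close>

lemma vector_derivative_norm_bound:
  fixes f :: "real \<Rightarrow> 'a::real_normed_vector"
  assumes "a \<le> b"
    and "\<And>t. t \<in> {a..b} \<Longrightarrow> (f has_vector_derivative f' t) (at t within {a..b})"
    and "\<And>t. t \<in> {a..b} \<Longrightarrow> norm (f' t) \<le> B"
  shows "norm (f b - f a) \<le> B * (b - a)"
proof -
  have "norm (f b - f a) \<le> B * norm (b - a)"
  proof (rule differentiable_bound[where S="{a..b}" and f'="\<lambda>t h. h *\<^sub>R f' t"])
    show "onorm (\<lambda>h. h *\<^sub>R f' t) \<le> B" if "t \<in> {a..b}" for t
      by (rule onorm_le) (use mult_right_mono[OF assms(3)[OF that] abs_ge_zero] in \<open>simp add: mult.commute\<close>)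
  qed (use assms in \<open>auto simp: has_vector_derivative_def\<close>)
  then show ?thesis using assms(1) by simp
qed

text \<open>The second difference of \<open>g\<close> in the directions \<open>v\<close>, \<open>w\<close> is symmetric, and differentiability
  at \<open>x\<close> of the directional derivative along \<open>v\<close> suffices to compare it with the mixed derivative.\<close>

lemma second_difference_estimate:
  fixes g :: "'a::real_normed_vector \<Rightarrow> 'b::real_normed_vector"
  assumes "open U" "x \<in> U" "\<And>z. z \<in> U \<Longrightarrow> (g has_derivative g' z) (at z)"
    and A: "((\<lambda>z. g' z v) has_derivative A) (at x)" and "e > 0"
  shows "\<exists>d>0. \<forall>t. 0 < t \<and> t < d \<longrightarrow>
    norm (g (x + t *\<^sub>R v + t *\<^sub>R w) - g (x + t *\<^sub>R v) - g (x + t *\<^sub>R w) + g x - t\<^sup>2 *\<^sub>R A w) \<le> e * t\<^sup>2"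
proof -
  define n where "n = norm v + norm w + 1"
  have n: "n > 0" "norm v \<le> n" "norm w \<le> n" "norm v + norm w \<le> n" by (auto simp: n_def add_nonneg_pos)
  \<comment> \<open>Two remainders of size at most \<open>e' * (t * n)\<close> occur, multiplied by
    \<open>t\<close>; with this choice they add up to \<open>e * t^2\<close>.\<close>
  define e' where "e' = e / (2 * n)"
  have e': "e' > 0" using \<open>e > 0\<close> n by (simp add: e'_def)
  obtain d0 where d0: "d0 > 0"
    "\<And>z. norm (z - x) < d0 \<Longrightarrow> norm (g' z v - g' x v - A (z - x)) \<le> e' * norm (z - x)"
    using A e' unfolding has_derivative_at_alt by meson
  obtain d1 where d1: "d1 > 0" "ball x d1 \<subseteq> U" using assms(1,2) open_contains_ball by metis
  have linA: "linear A" using A has_derivative_linear by blast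
  define d where "d = min d0 d1 / n"
  have "d > 0" using d0 d1 n by (simp add: d_def)
  moreover have "norm (g (x + t *\<^sub>R v + t *\<^sub>R w) - g (x + t *\<^sub>R v) - g (x + t *\<^sub>R w) + g x - t\<^sup>2 *\<^sub>R A w) \<le> e * t\<^sup>2"
    if t: "0 < t" "t < d" for t
  proof -
    have tn: "t * n < d0" "t * n < d1"
      using t n by (auto simp: d_def field_simps)
    \<comment> \<open>The increment of \<open>g\<close> by \<open>t w\<close> is moved along the
      segment from \<open>x\<close> to \<open>x + t v\<close>, so \<open>\<phi> 1 - \<phi> 0\<close>
      is the second difference minus \<open>t^2 A w\<close>. Only one differentiation, in the
      direction \<open>v\<close>, is needed to estimate it.\<close>
    define \<phi> where "\<phi> s = g (x + s *\<^sub>R (t *\<^sub>R v) + t *\<^sub>R w) - g (x + s *\<^sub>R (t *\<^sub>R v)) - s *\<^sub>R (t\<^sup>2 *\<^sub>R A w)" for s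
    define z1 z2 where "z1 s = x + s *\<^sub>R (t *\<^sub>R v) + t *\<^sub>R w" and "z2 s = x + s *\<^sub>R (t *\<^sub>R v)" for s :: real
    define \<phi>' where "\<phi>' s = g' (z1 s) (t *\<^sub>R v) - g' (z2 s) (t *\<^sub>R v) - t\<^sup>2 *\<^sub>R A w" for s
    have close: "norm (z1 s - x) \<le> t * n \<and> norm (z2 s - x) \<le> t * n" if s: "s \<in> {0..1}" for s
    proof -
      have sv: "norm (s *\<^sub>R (t *\<^sub>R v)) \<le> t * norm v"
        using s t by (auto intro!: mult_left_le_one_le)
      have "norm (z1 s - x) \<le> norm (s *\<^sub>R (t *\<^sub>R v)) + norm (t *\<^sub>R w)"
        using norm_triangle_ineq[of "s *\<^sub>R (t *\<^sub>R v)" "t *\<^sub>R w"] by (simp add: z1_def add.assoc)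
      also have "\<dots> \<le> t * (norm v + norm w)" using sv t by (simp add: algebra_simps)
      also have "\<dots> \<le> t * n" using n t by simp
      finally have 1: "norm (z1 s - x) \<le> t * n" .
      have "t * norm v \<le> t * n" using n t by simp
      with sv have "norm (z2 s - x) \<le> t * n" unfolding z2_def by simp
      with 1 show ?thesis by blast
    qed
    have inU: "z1 s \<in> U" "z2 s \<in> U" if "s \<in> {0..1}" for s
    proof -
      have "z1 s \<in> ball x d1" "z2 s \<in> ball x d1"
        using close[OF that] tn by (auto simp: dist_norm norm_minus_commute)
      then show "z1 s \<in> U" "z2 s \<in> U" using d1 by auto
    qed
    have "norm (\<phi> 1 - \<phi> 0) \<le> (e * t\<^sup>2) * (1 - 0)"
    proof (rule vector_derivative_norm_bound[where f'=\<phi>'])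
      fix s :: real assume s: "s \<in> {0..1}"
      have zd: "(z1 has_vector_derivative t *\<^sub>R v) (at s within {0..1})"
        "(z2 has_vector_derivative t *\<^sub>R v) (at s within {0..1})"
        unfolding z1_def z2_def by (auto intro!: derivative_eq_intros)
      have "((\<lambda>s. g (z1 s) - g (z2 s) - s *\<^sub>R (t\<^sup>2 *\<^sub>R A w)) has_vector_derivative \<phi>' s) (at s within {0..1})"
        unfolding \<phi>'_def
        by (intro has_vector_derivative_diff
            vector_derivative_diff_chain_within[OF zd(1), unfolded o_def]
            vector_derivative_diff_chain_within[OF zd(2), unfolded o_def]
            has_derivative_at_withinI[OF assms(3)] inU s)
          (auto intro!: derivative_eq_intros)
      then show "(\<phi> has_vector_derivative \<phi>' s) (at s within {0..1})"
        unfolding \<phi>_def z1_def z2_def .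
      have lin: "linear (g' (z1 s))" "linear (g' (z2 s))"
        using assms(3) inU[OF s] has_derivative_linear by blast+
      \<comment> \<open>The linear parts at the two points differ exactly by the term subtracted in
        \<open>\<phi>'\<close>; what survives are the two remainders of the derivative along
        \<open>v\<close> at \<open>x\<close>.\<close>
      have "A (z1 s - x) - A (z2 s - x) = t *\<^sub>R A w"
        unfolding linear_diff[OF linA, symmetric]
        by (simp add: z1_def z2_def linear_cmul[OF linA])
      then have "\<phi>' s = t *\<^sub>R ((g' (z1 s) v - g' x v - A (z1 s - x)) - (g' (z2 s) v - g' x v - A (z2 s - x)))"
        by (simp add: \<phi>'_def linear_cmul[OF lin(1)] linear_cmul[OF lin(2)] algebra_simps power2_eq_square)
      also have "norm \<dots> \<le> t * (e' * norm (z1 s - x) + e' * norm (z2 s - x))"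
      proof -
        have "norm ((g' (z1 s) v - g' x v - A (z1 s - x)) - (g' (z2 s) v - g' x v - A (z2 s - x)))
            \<le> e' * norm (z1 s - x) + e' * norm (z2 s - x)"
          using close[OF s] tn
          by (intro order_trans[OF norm_triangle_ineq4] add_mono d0(2)) auto
        then show ?thesis using t by simp
      qed
      also have "\<dots> \<le> t * (e' * (t * n) + e' * (t * n))"
        using close[OF s] t e' by (intro mult_left_mono add_mono) auto
      also have "\<dots> = e * t\<^sup>2"
        using n by (simp add: e'_def power2_eq_square field_simps)
      finally show "norm (\<phi>' s) \<le> e * t\<^sup>2" .
    qed simp
    moreover have "\<phi> 1 - \<phi> 0 = g (x + t *\<^sub>R v + t *\<^sub>R w) - g (x + t *\<^sub>R v) - g (x + t *\<^sub>R w) + g x - t\<^sup>2 *\<^sub>R A w"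
      by (simp add: \<phi>_def)
    ultimately show ?thesis by simp
  qed
  ultimately show ?thesis by blast
qed

text \<open>Both sides approximate the same second difference divided by \<open>t^2\<close>:
  exchanging \<open>v\<close> and \<open>w\<close> merely swaps its two middle terms. Comparing the
  two estimates at a common small \<open>t\<close> gives a gap of at most \<open>e\<close>.\<close>

lemma second_derivative_symmetric:
  fixes g :: "'a::real_normed_vector \<Rightarrow> 'b::real_normed_vector"
  assumes "open U" "x \<in> U" "\<And>z. z \<in> U \<Longrightarrow> (g has_derivative g' z) (at z)"
    and A: "((\<lambda>z. g' z v) has_derivative A) (at x)"
    and B: "((\<lambda>z. g' z w) has_derivative B) (at x)"
  shows "A w = B v"
proof -
  have "norm (A w - B v) \<le> e" if "e > 0" for e
  proof -
    have e2: "e / 2 > 0" using that by simp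
    obtain d1 where d1: "d1 > 0" "\<And>t. 0 < t \<Longrightarrow> t < d1 \<Longrightarrow>
      norm (g (x + t *\<^sub>R v + t *\<^sub>R w) - g (x + t *\<^sub>R v) - g (x + t *\<^sub>R w) + g x - t\<^sup>2 *\<^sub>R A w) \<le> e / 2 * t\<^sup>2"
      using second_difference_estimate[OF assms(1-3) A e2] by blast
    obtain d2 where d2: "d2 > 0" "\<And>t. 0 < t \<Longrightarrow> t < d2 \<Longrightarrow>
      norm (g (x + t *\<^sub>R w + t *\<^sub>R v) - g (x + t *\<^sub>R w) - g (x + t *\<^sub>R v) + g x - t\<^sup>2 *\<^sub>R B v) \<le> e / 2 * t\<^sup>2"
      using second_difference_estimate[OF assms(1-3) B e2] by blast
    obtain t where t: "0 < t" "t < d1" "t < d2"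
      using d1(1) d2(1) by (meson dense min_less_iff_conj)
    define \<Delta> where "\<Delta> = g (x + t *\<^sub>R v + t *\<^sub>R w) - g (x + t *\<^sub>R v) - g (x + t *\<^sub>R w) + g x"
    have comm: "g (x + t *\<^sub>R w + t *\<^sub>R v) - g (x + t *\<^sub>R w) - g (x + t *\<^sub>R v) + g x = \<Delta>"
      by (simp add: \<Delta>_def algebra_simps)
    have "norm (\<Delta> - t\<^sup>2 *\<^sub>R A w) \<le> e / 2 * t\<^sup>2" using d1(2) t unfolding \<Delta>_def by blast
    moreover have "norm (\<Delta> - t\<^sup>2 *\<^sub>R B v) \<le> e / 2 * t\<^sup>2" using d2(2)[of t] t unfolding comm by blast
    moreover have "norm (t\<^sup>2 *\<^sub>R (A w - B v)) \<le> norm (\<Delta> - t\<^sup>2 *\<^sub>R A w) + norm (\<Delta> - t\<^sup>2 *\<^sub>R B v)"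
      using norm_triangle_ineq4[of "\<Delta> - t\<^sup>2 *\<^sub>R B v" "\<Delta> - t\<^sup>2 *\<^sub>R A w"] by (simp add: algebra_simps)
    ultimately have "norm (t\<^sup>2 *\<^sub>R (A w - B v)) \<le> e / 2 * t\<^sup>2 + e / 2 * t\<^sup>2" by linarith
    then have "t\<^sup>2 * norm (A w - B v) \<le> t\<^sup>2 * e" unfolding norm_scaleR by (simp add: mult.commute)
    then show ?thesis using t(1) by simp
  qed
  then have "norm (A w - B v) \<le> 0" using field_le_epsilon[of "norm (A w - B v)" 0] by simp
  then show ?thesis by simp
qed

text \<open>Directional derivatives are uniformly continuous on the compact set, and convexity keeps
  the segment from \<open>x\<close> to \<open>y\<close> inside it. One radius \<open>d\<close> for
  all base points is required because the expansion of \<open>B\<close> is later used simultaneously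
  along a whole curve.\<close>

lemma Ck_uniform_differentiability:
  fixes f :: "'a::euclidean_space \<Rightarrow> 'b::real_normed_vector"
  assumes "Ck_on (Suc k) U f" "compact K" "convex K" "K \<subseteq> U" "e > 0"
  shows "\<exists>d>0. \<forall>x\<in>K. \<forall>y\<in>K. norm (y - x) < d \<longrightarrow>
    norm (f y - f x - frechet_derivative f (at x) (y - x)) \<le> e * norm (y - x)"
proof -
  define f' where "f' x = frechet_derivative f (at x)" for x
  have f': "(f has_derivative f' x) (at x)" if "x \<in> K" for x
    unfolding f'_def using Ck_on_imp_has_derivative[OF assms(1)] assms(4) that by blast
  \<comment> \<open>The operator norm is estimated by a sum over the basis, with
    \<open>DIM('a)\<close> summands of size \<open>e'\<close>.\<close>
  define e' where "e' = e / DIM('a)"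
  have e': "e' > 0" using assms(5) by (simp add: e'_def)
  have "\<exists>d>0. \<forall>x\<in>K. \<forall>y\<in>K. norm (y - x) < d \<longrightarrow> norm (f' y b - f' x b) < e'" for b
  proof -
    have "Ck_on k U (\<lambda>x. f' x b)" using assms(1) by (simp add: f'_def)
    then have "continuous_on K (\<lambda>x. f' x b)"
      using Ck_on_imp_continuous continuous_on_subset assms(4) by blast
    then have "uniformly_continuous_on K (\<lambda>x. f' x b)"
      using assms(2) compact_uniformly_continuous by blast
    then show ?thesis
      using e' unfolding uniformly_continuous_on_def dist_norm by meson
  qed
  then obtain d where d: "\<And>b. d b > 0"
    "\<And>b x y. x \<in> K \<Longrightarrow> y \<in> K \<Longrightarrow> norm (y - x) < d b \<Longrightarrow> norm (f' y b - f' x b) < e'"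
    by metis
  define \<delta> where "\<delta> = Min (d ` (Basis :: 'a set))"
  have \<delta>: "\<delta> > 0" "\<And>b. b \<in> (Basis :: 'a set) \<Longrightarrow> \<delta> \<le> d b"
    using d(1) by (auto simp: \<delta>_def)
  have "norm (f y - f x - f' x (y - x)) \<le> e * norm (y - x)"
    if xy: "x \<in> K" "y \<in> K" "norm (y - x) < \<delta>" for x y
  proof -
    have "norm (f y - f x - f' x (y - x)) \<le> norm (y - x) * e"
    proof (rule differentiable_bound_linearization[where S="closed_segment x y" and f'=f'])
      have seg: "closed_segment x y \<subseteq> K" using xy assms(3) closed_segment_subset by blast
      show "x + t *\<^sub>R (y - x) \<in> closed_segment x y" if "t \<in> {0..1}" for t
        using that by (auto simp: closed_segment_def algebra_simps intro!: exI[of _ t])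
      show "(f has_derivative f' z) (at z within closed_segment x y)" if "z \<in> closed_segment x y" for z
        using f' seg that has_derivative_at_withinI by blast
      show "onorm (f' z - f' x) \<le> e" if z: "z \<in> closed_segment x y" for z
      proof (rule onorm_le)
        fix h
        have zK: "z \<in> K" using seg z by blast
        have "norm (z - x) \<le> norm (y - x)"
          using segment_bound(1)[OF z] by (simp add: norm_minus_commute)
        then have zx: "norm (z - x) < d b" if "b \<in> Basis" for b
          using xy(3) \<delta>(2)[OF that] by simp
        have "(f' z - f' x) h = (\<Sum>b\<in>Basis. (h \<bullet> b) *\<^sub>R (f' z b - f' x b))"
          using linear_basis_expansion[OF has_derivative_linear[OF f'[OF zK]], of h]
            linear_basis_expansion[OF has_derivative_linear[OF f'[OF xy(1)]], of h]
          by (simp add: sum_subtractf[symmetric] scaleR_diff_right)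
        also have "norm \<dots> \<le> (\<Sum>b\<in>(Basis::'a set). norm h * e')"
        proof (rule sum_norm_le)
          fix b :: 'a assume b: "b \<in> Basis"
          then show "norm ((h \<bullet> b) *\<^sub>R (f' z b - f' x b)) \<le> norm h * e'"
            using d(2)[OF xy(1) zK zx[OF b]] by (auto intro!: mult_mono Basis_le_norm)
        qed
        also have "\<dots> = e * norm h" by (simp add: e'_def)
        finally show "norm ((f' z - f' x) h) \<le> e * norm h" .
      qed
    qed simp
    then show ?thesis by (simp add: mult.commute)
  qed
  then show ?thesis using \<delta>(1) unfolding f'_def by blast
qed

lemma Ck_lipschitz:
  fixes f :: "'a::euclidean_space \<Rightarrow> 'b::real_normed_vector"
  assumes "Ck_on (Suc k) U f" "compact K" "convex K" "K \<subseteq> U"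
  shows "\<exists>L\<ge>0. \<forall>x\<in>K. \<forall>y\<in>K. norm (f y - f x) \<le> L * norm (y - x)"
proof -
  define f' where "f' x = frechet_derivative f (at x)" for x
  have f': "(f has_derivative f' x) (at x)" if "x \<in> K" for x
    unfolding f'_def using Ck_on_imp_has_derivative[OF assms(1)] assms(4) that by blast
  have "\<exists>B\<ge>0. \<forall>x\<in>K. norm (f' x b) \<le> B" for b
  proof -
    have "Ck_on k U (\<lambda>x. f' x b)" using assms(1) by (simp add: f'_def)
    then have "continuous_on K (\<lambda>x. f' x b)"
      using Ck_on_imp_continuous continuous_on_subset assms(4) by blast
    then have "bounded ((\<lambda>x. f' x b) ` K)"
      using compact_continuous_image compact_imp_bounded assms(2) by blast
    then show ?thesis unfolding bounded_pos by (metis image_eqI less_imp_le)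
  qed
  then obtain C where C: "\<And>b. C b \<ge> 0" "\<And>b x. x \<in> K \<Longrightarrow> norm (f' x b) \<le> C b" by metis
  define L where "L = (\<Sum>b\<in>(Basis::'a set). C b)"
  have "norm (f y - f x) \<le> L * norm (y - x)" if "x \<in> K" "y \<in> K" for x y
  proof (rule differentiable_bound[OF assms(3) _ _ that(2,1), where f'=f'])
    show "(f has_derivative f' z) (at z within K)" if "z \<in> K" for z
      using f' that has_derivative_at_withinI by blast
    show "onorm (f' z) \<le> L" if z: "z \<in> K" for z
    proof (rule onorm_le)
      fix h
      have "norm (f' z h) \<le> (\<Sum>b\<in>(Basis::'a set). norm h * C b)"
        unfolding linear_basis_expansion[OF has_derivative_linear[OF f'[OF z]], of h]
        by (rule sum_norm_le) (use C z in \<open>auto intro!: mult_mono Basis_le_norm\<close>)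
      then show "norm (f' z h) \<le> L * norm h" by (simp add: L_def sum_distrib_left mult.commute)
    qed
  qed
  moreover have "L \<ge> 0" by (simp add: L_def C sum_nonneg)
  ultimately show ?thesis by blast
qed

text \<open>The integral operator contracts by the Lipschitz constant times the length of the
  interval, which is 1 here. In the application the Lipschitz constant is made small by a small
  parameter \<open>w\<close>, so that every such parameter admits a solution up to time 1.\<close>

lemma picard:
  fixes V :: "'a::euclidean_space \<Rightarrow> 'a"
  assumes "0 \<le> L" "L < 1" and lip: "\<And>x y. norm (V x - V y) \<le> L * norm (x - y)"
  shows "\<exists>\<gamma>. \<gamma> 0 = x0 \<and> (\<forall>t\<in>{0..1}. (\<gamma> has_vector_derivative V (\<gamma> t)) (at t within {0..1::real}))"
proof -
  have contV: "continuous_on UNIV V"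
    using lip assms(1) by (intro lipschitz_on_continuous_on[of L]) (auto simp: lipschitz_on_def dist_norm)
  \<comment> \<open>Clamping time to the unit interval makes the curves bounded continuous functions
    on the whole line, a complete space on which the Banach fixed point theorem applies
    directly.\<close>
  define cl where "cl t = max 0 (min 1 t)" for t :: real
  have cl: "cl t \<in> {0..1}" "t \<in> {0..1} \<Longrightarrow> cl t = t" for t by (auto simp: cl_def)
  have contcl: "continuous_on UNIV cl" unfolding cl_def by (intro continuous_intros)
  define P where "P \<gamma> t = x0 + integral {0..cl t} (\<lambda>s. V (apply_bcontfun \<gamma> s))" for \<gamma> :: "real \<Rightarrow>\<^sub>C 'a" and t
  have contVg: "continuous_on S (\<lambda>s. V (apply_bcontfun \<gamma> s))" for \<gamma> :: "real \<Rightarrow>\<^sub>C 'a" and S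
    by (rule continuous_on_compose2[OF contV]) auto
  have P: "P \<gamma> \<in> bcontfun" for \<gamma>
  proof -
    have c: "continuous_on {0..1} (\<lambda>t. x0 + integral {0..t} (\<lambda>s. V (apply_bcontfun \<gamma> s)))"
      by (intro continuous_intros indefinite_integral_continuous_1 integrable_continuous_real contVg)
    have 1: "continuous_on UNIV (P \<gamma>)"
      unfolding P_def by (rule continuous_on_compose2[OF c contcl]) (use cl in auto)
    have "bounded ((\<lambda>t. x0 + integral {0..t} (\<lambda>s. V (apply_bcontfun \<gamma> s))) ` {0..1})"
      using compact_continuous_image[OF c] compact_imp_bounded by blast
    then have "bounded (range (P \<gamma>))"
      by (rule bounded_subset) (use cl in \<open>auto simp: P_def\<close>)
    with 1 show ?thesis by (simp add: bcontfun_def)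
  qed
  have "\<exists>!\<gamma>. Bcontfun (P \<gamma>) = \<gamma>"
  proof (rule banach_fix_type[OF assms(1,2)], intro allI)
    fix \<gamma> \<eta> :: "real \<Rightarrow>\<^sub>C 'a"
    show "dist (Bcontfun (P \<gamma>)) (Bcontfun (P \<eta>)) \<le> L * dist \<gamma> \<eta>"
    proof (rule dist_bound)
      fix t
      have "P \<gamma> t - P \<eta> t = integral {0..cl t} (\<lambda>s. V (apply_bcontfun \<gamma> s) - V (apply_bcontfun \<eta> s))"
        unfolding P_def by (simp add: integral_diff integrable_continuous_real contVg)
      also have "norm \<dots> \<le> (L * dist \<gamma> \<eta>) * (cl t - 0)"
      proof (rule integral_bound)
        show "norm (V (apply_bcontfun \<gamma> s) - V (apply_bcontfun \<eta> s)) \<le> L * dist \<gamma> \<eta>" for s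
          using lip[of "apply_bcontfun \<gamma> s" "apply_bcontfun \<eta> s"] dist_bounded[of \<gamma> s \<eta>] assms(1)
          by (smt (verit) dist_norm mult_left_mono)
      qed (use cl contVg in \<open>auto intro!: continuous_intros\<close>)
      also have "\<dots> \<le> L * dist \<gamma> \<eta>"
        using cl[of t] assms(1) by (simp add: mult_left_le)
      finally show "dist (apply_bcontfun (Bcontfun (P \<gamma>)) t) (apply_bcontfun (Bcontfun (P \<eta>)) t) \<le> L * dist \<gamma> \<eta>"
        by (simp add: Bcontfun_inverse P dist_norm)
    qed
  qed
  then obtain \<gamma> where "Bcontfun (P \<gamma>) = \<gamma>" by blast
  then have \<gamma>: "apply_bcontfun \<gamma> = P \<gamma>" using Bcontfun_inverse[OF P] by metis
  show ?thesis
  proof (intro exI[of _ "apply_bcontfun \<gamma>"] conjI ballI)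
    have "P \<gamma> 0 = x0" by (simp add: P_def cl_def)
    then show "apply_bcontfun \<gamma> 0 = x0" by (simp only: \<gamma>)
    fix t :: real assume t: "t \<in> {0..1}"
    have "((\<lambda>t. x0 + integral {0..t} (\<lambda>s. V (apply_bcontfun \<gamma> s))) has_vector_derivative
        0 + V (apply_bcontfun \<gamma> t)) (at t within {0..1})"
      by (intro has_vector_derivative_add has_vector_derivative_const integral_has_vector_derivative contVg t)
    then have "(P \<gamma> has_vector_derivative 0 + V (apply_bcontfun \<gamma> t)) (at t within {0..1})"
      by (rule has_vector_derivative_transform[OF t, rotated]) (use cl in \<open>simp add: P_def\<close>)
    then show "(apply_bcontfun \<gamma> has_vector_derivative V (apply_bcontfun \<gamma> t)) (at t within {0..1})"
      by (simp only: \<gamma>[symmetric] add_0)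
  qed
qed

section \<open>Total differential equations\<close>

text \<open>For \<open>w\<close> near \<open>0\<close> let \<open>\<gamma>\<close> solve \<open>\<gamma>' = B(\<gamma>) w\<close>, \<open>\<gamma>(0) = x\<^sub>0\<close>, and put \<open>f w = \<gamma>(1)\<close>. By the
  integrability condition, \<open>\<gamma>(t) + t B(\<gamma>(t)) v\<close> solves the equation for \<open>w + v\<close> up to an error \<open>o(v)\<close>;
  as the equation is a contraction, this gives \<open>f (w + v) = f w + B(f w) v + o(v)\<close> without any
  appeal to differentiable dependence of solutions on parameters.\<close>

lemma total_differential_equation:
  fixes B :: "real^'m::finite \<Rightarrow> real^'n::finite^'m"
  assumes "open U" "x0 \<in> U" and CB: "Ck_on (Suc k) U B"
    and int: "\<And>x v w. x \<in> U \<Longrightarrow>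
      frechet_derivative B (at x) (B x *v w) *v v = frechet_derivative B (at x) (B x *v v) *v w"
  shows "\<exists>\<delta>>0. \<exists>f. f 0 = x0 \<and> (\<forall>w\<in>ball 0 \<delta>. f w \<in> U \<and> (f has_derivative (\<lambda>v. B (f w) *v v)) (at w))"
proof -
  obtain C where C: "C > 0" "\<And>(A::real^'n^'m) v. norm (A *v v) \<le> norm A * norm v * C"
    using bounded_bilinear.pos_bounded[OF bounded_bilinear_matrix_vector] by blast
  obtain R where R: "R > 0" "cball x0 R \<subseteq> U" using assms(1,2) open_contains_cball by metis
  define K where "K = cball x0 R"
  have K: "compact K" "convex K" "K \<subseteq> U" "closed K" "K \<noteq> {}" "x0 \<in> K" using R by (auto simp: K_def)
  obtain L where L: "L \<ge> 0" "\<And>x y. x \<in> K \<Longrightarrow> y \<in> K \<Longrightarrow> norm (B y - B x) \<le> L * norm (y - x)"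
    using Ck_lipschitz[OF CB K(1-3)] by blast
  have "bounded (B ` K)"
    using Ck_on_imp_continuous[OF CB] continuous_on_subset[OF _ K(3)] compact_continuous_image K(1)
      compact_imp_bounded by blast
  then obtain b where b: "b > 0" "\<And>x. x \<in> K \<Longrightarrow> norm (B x) \<le> b"
    unfolding bounded_pos by blast
  \<comment> \<open>The nearest-point projection onto the convex set \<open>K\<close> does not
    increase distances, so \<open>Bt\<close> is a bounded and globally Lipschitz extension of
    \<open>B\<close>, as \<open>picard\<close> requires. The solutions turn out to stay in
    \<open>K\<close>, where \<open>Bt\<close> is \<open>B\<close>.\<close>
  define Bt where "Bt x = B (closest_point K x)" for x
  have cpK: "closest_point K x \<in> K" for x using closest_point_in_set K by blast
  have Bt_lip: "norm (Bt x - Bt y) \<le> L * norm (x - y)" for x y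
  proof -
    have "norm (Bt x - Bt y) \<le> L * norm (closest_point K x - closest_point K y)"
      unfolding Bt_def using L(2)[OF cpK cpK] .
    also have "\<dots> \<le> L * norm (x - y)"
      using closest_point_lipschitz[OF K(2,4,5)] L(1) by (auto simp: dist_norm intro!: mult_left_mono)
    finally show ?thesis .
  qed
  have Bt_bound: "norm (Bt x) \<le> b" for x unfolding Bt_def using b(2) cpK by blast
  have Bt_eq: "Bt x = B x" if "x \<in> K" for x using closest_point_self[OF that] by (simp add: Bt_def)
  \<comment> \<open>The first bound makes the contraction factor \<open>C * L * norm w\<close> at
    most 1/2, the \<open>+ 1\<close> covering the case \<open>L = 0\<close>. The second keeps a
    curve of speed at most \<open>C * b * norm w\<close> within distance \<open>R\<close> of
    \<open>x0\<close> up to time 1.\<close>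
  define \<delta> where "\<delta> = min (1 / (2 * (C * L + 1))) (R / (C * b))"
  have CL: "C * L \<ge> 0" using C L by simp
  have \<delta>: "\<delta> > 0" "\<delta> * (C * b) \<le> R" "C * L * \<delta> \<le> 1 / 2"
  proof -
    show "\<delta> > 0" unfolding \<delta>_def using CL R b C by auto
    show "\<delta> * (C * b) \<le> R" using b C by (simp add: \<delta>_def min_def field_simps)
    have "C * L * \<delta> \<le> C * L * (1 / (2 * (C * L + 1)))" unfolding \<delta>_def using CL by (intro mult_left_mono) auto
    also have "\<dots> \<le> 1 / 2" using CL by (simp add: field_simps)
    finally show "C * L * \<delta> \<le> 1 / 2" .
  qed
  have "\<exists>\<gamma>. \<gamma> 0 = x0 \<and> (\<forall>t\<in>{0..1}. (\<gamma> has_vector_derivative Bt (\<gamma> t) *v w) (at t within {0..1::real}))"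
    if w: "norm w < \<delta>" for w
  proof (rule picard)
    show "0 \<le> C * L * norm w" using CL by simp
    have "C * L * norm w \<le> C * L * \<delta>" using w CL by (intro mult_left_mono) auto
    then show "C * L * norm w < 1" using \<delta>(3) by linarith
    fix x y
    have "norm (Bt x *v w - Bt y *v w) = norm ((Bt x - Bt y) *v w)"
      by (simp add: matrix_vector_mult_diff_rdistrib)
    also have "\<dots> \<le> norm (Bt x - Bt y) * norm w * C" by (rule C(2))
    also have "\<dots> \<le> L * norm (x - y) * norm w * C"
      using Bt_lip C by (intro mult_right_mono) auto
    finally show "norm (Bt x *v w - Bt y *v w) \<le> C * L * norm w * norm (x - y)" by (simp add: ac_simps)
  qed
  then obtain \<gamma> where \<gamma>0: "\<And>w. norm w < \<delta> \<Longrightarrow> \<gamma> w 0 = x0"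
    and \<gamma>': "\<And>w t. norm w < \<delta> \<Longrightarrow> t \<in> {0..1} \<Longrightarrow>
      (\<gamma> w has_vector_derivative Bt (\<gamma> w t) *v w) (at t within {0..1::real})"
    by metis
  have dist\<gamma>: "norm (\<gamma> w t - x0) \<le> C * b * norm w" if w: "norm w < \<delta>" and t: "t \<in> {0..1}" for w t
  proof -
    have "norm (\<gamma> w t - \<gamma> w 0) \<le> (C * b * norm w) * (t - 0)"
    proof (rule vector_derivative_norm_bound[where f'="\<lambda>t. Bt (\<gamma> w t) *v w"])
      show "(\<gamma> w has_vector_derivative Bt (\<gamma> w s) *v w) (at s within {0..t})" if "s \<in> {0..t}" for s
        by (rule has_vector_derivative_within_subset[OF \<gamma>'[OF w]]) (use t that in auto)
      fix s
      have "norm (Bt (\<gamma> w s) *v w) \<le> norm (Bt (\<gamma> w s)) * norm w * C" by (rule C(2))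
      also have "\<dots> \<le> b * norm w * C" using Bt_bound C by (intro mult_right_mono) auto
      finally show "norm (Bt (\<gamma> w s) *v w) \<le> C * b * norm w" by (simp add: ac_simps)
    qed (use t in auto)
    also have "\<dots> \<le> C * b * norm w"
      using t C b by (simp add: mult_left_le)
    finally show ?thesis using \<gamma>0[OF w] by simp
  qed
  have \<gamma>K: "\<gamma> w t \<in> K" if w: "norm w < \<delta>" and t: "t \<in> {0..1}" for w t
  proof -
    have "C * b * norm w \<le> C * b * \<delta>" using w C b by (intro mult_left_mono) auto
    then show ?thesis using dist\<gamma>[OF that] \<delta>(2)
      by (simp add: K_def dist_norm norm_minus_commute mult.commute)
  qed
  define f where "f w = \<gamma> w 1" for w
  have "(f has_derivative (\<lambda>v. B (f w) *v v)) (at w)" if w: "norm w < \<delta>" for w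
    unfolding has_derivative_at_alt
  proof (intro conjI allI impI)
    show "bounded_linear (\<lambda>v. B (f w) *v v)" by (rule matrix_vector_mul_bounded_linear)
    fix \<eta> :: real assume \<eta>: "\<eta> > 0"
    define M where "M = C * (C * b)"
    have M: "M > 0" using C b by (simp add: M_def)
    \<comment> \<open>The defect \<open>e'\<close> below splits into three terms. One is absorbed
      into the supremum of the error; the other two may cost \<open>\<eta> / 4 * norm v\<close>
      each, and \<open>\<epsilon>\<close> is the relative error allowed in the linearization of
      \<open>B\<close>.\<close>
    define \<epsilon> where "\<epsilon> = \<eta> / (4 * (M * \<delta>))"
    have \<epsilon>: "\<epsilon> > 0" using \<eta> M \<delta> by (simp add: \<epsilon>_def)
    obtain d where d: "d > 0" "\<And>x y. x \<in> K \<Longrightarrow> y \<in> K \<Longrightarrow> norm (y - x) < d \<Longrightarrow>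
        norm (B y - B x - frechet_derivative B (at x) (y - x)) \<le> \<epsilon> * norm (y - x)"
      using Ck_uniform_differentiability[OF CB K(1-3) \<epsilon>] by blast
    \<comment> \<open>The entries keep \<open>z\<close> in the ball of radius
      \<open>\<delta>\<close>, keep the displacement \<open>u\<close> within the range of the
      linearization of \<open>B\<close>, and bound the term quadratic in \<open>v\<close>.\<close>
    define d' where "d' = Min {\<delta> - norm w, d / (C * b), \<eta> / (4 * (M * L + 1))}"
    have MLnn: "M * L \<ge> 0" using M L by simp
    have d': "d' > 0" "d' \<le> \<delta> - norm w" "d' * (C * b) \<le> d" "d' * (M * L) \<le> \<eta> / 4"
    proof -
      have "\<eta> / (4 * (M * L + 1)) > 0" using \<eta> MLnn by simp
      then show "d' > 0" unfolding d'_def using d(1) C b w by auto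
      show "d' \<le> \<delta> - norm w" by (simp add: d'_def)
      have "d' \<le> d / (C * b)" by (simp add: d'_def)
      then show "d' * (C * b) \<le> d" using C b by (simp add: field_simps)
      have "d' \<le> \<eta> / (4 * (M * L + 1))" by (simp add: d'_def)
      then have "d' * (M * L) \<le> \<eta> / (4 * (M * L + 1)) * (M * L)" using MLnn by (intro mult_right_mono)
      also have "\<dots> \<le> \<eta> / 4" using MLnn \<eta> by (simp add: field_simps)
      finally show "d' * (M * L) \<le> \<eta> / 4" .
    qed
    have "norm (f z - f w - B (f w) *v (z - w)) \<le> \<eta> * norm (z - w)" if z: "norm (z - w) < d'" for z
    proof -
      define v where "v = z - w"
      have v: "norm v < d'" "z = w + v" using z by (auto simp: v_def)
      have z\<delta>: "norm z < \<delta>" using norm_triangle_ineq[of w v] v d'(2) by simp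
      define \<sigma> where "\<sigma> t = \<gamma> w t + t *\<^sub>R (B (\<gamma> w t) *v v)" for t
      define DB where "DB t = frechet_derivative B (at (\<gamma> w t))" for t
      define e where "e t = \<gamma> z t - \<sigma> t" for t
      define e' where "e' t = Bt (\<gamma> z t) *v z - (B (\<gamma> w t) *v w + (t *\<^sub>R (DB t (B (\<gamma> w t) *v w) *v v) + B (\<gamma> w t) *v v))" for t
      have Bv: "norm (B (\<gamma> w t) *v v) \<le> C * b * norm v" if "t \<in> {0..1}" for t
      proof -
        have "norm (B (\<gamma> w t) *v v) \<le> norm (B (\<gamma> w t)) * norm v * C" by (rule C(2))
        also have "\<dots> \<le> b * norm v * C" using b(2)[OF \<gamma>K[OF w that]] C by (intro mult_right_mono) auto
        finally show ?thesis by (simp add: ac_simps)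
      qed
      have tBv: "norm (t *\<^sub>R (B (\<gamma> w t) *v v)) \<le> C * b * norm v" if t: "t \<in> {0..1}" for t
      proof -
        have "norm (t *\<^sub>R (B (\<gamma> w t) *v v)) \<le> norm (B (\<gamma> w t) *v v)"
          using t by (simp add: mult_left_le_one_le)
        then show ?thesis using Bv[OF t] by linarith
      qed
      have \<sigma>K: "\<sigma> t \<in> K" if t: "t \<in> {0..1}" for t
      proof -
        have "\<sigma> t - x0 = (\<gamma> w t - x0) + t *\<^sub>R (B (\<gamma> w t) *v v)" by (simp add: \<sigma>_def)
        then have "norm (\<sigma> t - x0) \<le> norm (\<gamma> w t - x0) + norm (t *\<^sub>R (B (\<gamma> w t) *v v))"
          by (simp only: norm_triangle_ineq)
        also have "\<dots> \<le> C * b * norm w + C * b * norm v" using dist\<gamma>[OF w t] tBv[OF t] by linarith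
        also have "\<dots> = (norm w + norm v) * (C * b)" by (simp add: algebra_simps)
        also have "\<dots> \<le> \<delta> * (C * b)" using v d'(2) C b by (intro mult_right_mono) auto
        finally show ?thesis using \<delta>(2) by (simp add: K_def dist_norm norm_minus_commute)
      qed
      have e_deriv: "(e has_vector_derivative e' t) (at t within {0..1})" if t: "t \<in> {0..1}" for t
      proof -
        have g: "(\<gamma> w has_vector_derivative B (\<gamma> w t) *v w) (at t within {0..1})"
          using \<gamma>'[OF w t] Bt_eq[OF \<gamma>K[OF w t]] by simp
        have DBd: "(B has_derivative DB t) (at (\<gamma> w t))"
          unfolding DB_def using Ck_on_imp_has_derivative[OF CB] \<gamma>K[OF w t] K(3) by blast
        have "((\<lambda>s. B (\<gamma> w s)) has_vector_derivative DB t (B (\<gamma> w t) *v w)) (at t within {0..1})"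
          using vector_derivative_diff_chain_within[OF g has_derivative_at_withinI[OF DBd]] by (simp add: o_def)
        then have "((\<lambda>s. B (\<gamma> w s) *v v) has_vector_derivative DB t (B (\<gamma> w t) *v w) *v v) (at t within {0..1})"
          by (rule bounded_linear.has_vector_derivative[OF
                bounded_bilinear.bounded_linear_left[OF bounded_bilinear_matrix_vector]])
        from has_vector_derivative_scaleR[OF DERIV_ident this]
        have "((\<lambda>s. s *\<^sub>R (B (\<gamma> w s) *v v)) has_vector_derivative
            (t *\<^sub>R (DB t (B (\<gamma> w t) *v w) *v v) + B (\<gamma> w t) *v v)) (at t within {0..1})" by simp
        then show ?thesis
          unfolding e_def e'_def \<sigma>_def
          by (intro has_vector_derivative_diff has_vector_derivative_add g \<gamma>'[OF z\<delta> t])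
      qed
      have "continuous_on {0..1} (\<lambda>t. norm (e t))"
        using has_vector_derivative_continuous[OF e_deriv]
        by (intro continuous_on_norm) (simp add: continuous_on_eq_continuous_within)
      then obtain t0 where t0: "t0 \<in> {0..1}" "\<And>t. t \<in> {0..1} \<Longrightarrow> norm (e t) \<le> norm (e t0)"
        using continuous_attains_sup[of "{0..1::real}" "\<lambda>t. norm (e t)"] by auto
      \<comment> \<open>Absorption takes the place of a Gronwall argument: since
        \<open>e 0 = 0\<close> and \<open>e'\<close> is bounded by
        \<open>S / 2 + \<eta> / 2 * norm v\<close>, integrating up to \<open>t0\<close>, which is at
        most 1, gives \<open>S \<le> \<eta> * norm v\<close>.\<close>
      define S where "S = norm (e t0)"
      have e'_bound: "norm (e' t) \<le> S / 2 + \<eta> / 2 * norm v" if t: "t \<in> {0..1}" for t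
      proof -
        define u where "u = t *\<^sub>R (B (\<gamma> w t) *v v)"
        have u: "norm u \<le> C * b * norm v" using tBv[OF t] by (simp add: u_def)
        have \<gamma>U: "\<gamma> w t \<in> U" using \<gamma>K[OF w t] K(3) by blast
        have linDB: "linear (DB t)"
          unfolding DB_def using Ck_on_imp_has_derivative[OF CB \<gamma>U] has_derivative_linear by blast
        have "DB t (B (\<gamma> w t) *v w) *v v = DB t (B (\<gamma> w t) *v v) *v w"
          unfolding DB_def by (rule int[OF \<gamma>U])
        \<comment> \<open>The integrability condition enters only here: it turns the derivative of
          the correction term into the first-order change of \<open>B\<close> applied to
          \<open>w\<close> between the curve \<open>\<gamma> w\<close> and its correction
          \<open>\<sigma>\<close>.\<close>
        then have DBu: "t *\<^sub>R (DB t (B (\<gamma> w t) *v w) *v v) = DB t u *v w"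
          unfolding u_def linear_cmul[OF linDB] by (simp only: scaleR_matrix_vector_assoc)
        have e'_eq: "e' t = (Bt (\<gamma> z t) - Bt (\<sigma> t)) *v z + (B (\<sigma> t) - B (\<gamma> w t)) *v v
            + (B (\<sigma> t) - B (\<gamma> w t) - DB t u) *v w"
          unfolding e'_def Bt_eq[OF \<sigma>K[OF t]] v(2) DBu
          by (simp add: matrix_vector_mult_diff_rdistrib matrix_vector_right_distrib)
        have 1: "norm ((Bt (\<gamma> z t) - Bt (\<sigma> t)) *v z) \<le> S / 2"
        proof -
          have "norm ((Bt (\<gamma> z t) - Bt (\<sigma> t)) *v z) \<le> norm (Bt (\<gamma> z t) - Bt (\<sigma> t)) * norm z * C"
            by (rule C(2))
          also have "\<dots> \<le> (L * S) * \<delta> * C"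
          proof (intro mult_right_mono mult_mono)
            have "norm (Bt (\<gamma> z t) - Bt (\<sigma> t)) \<le> L * norm (e t)" unfolding e_def by (rule Bt_lip)
            also have "\<dots> \<le> L * S" unfolding S_def using t0(2)[OF t] L(1) by (rule mult_left_mono)
            finally show "norm (Bt (\<gamma> z t) - Bt (\<sigma> t)) \<le> L * S" .
          qed (use z\<delta> L(1) C in \<open>auto simp: S_def\<close>)
          also have "\<dots> = (C * L * \<delta>) * S" by (simp add: ac_simps)
          also have "\<dots> \<le> 1 / 2 * S" using \<delta>(3) by (rule mult_right_mono) (simp add: S_def)
          finally show ?thesis by simp
        qed
        have \<sigma>\<gamma>: "\<sigma> t - \<gamma> w t = u" by (simp add: \<sigma>_def u_def)
        have 2: "norm ((B (\<sigma> t) - B (\<gamma> w t)) *v v) \<le> \<eta> / 4 * norm v"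
        proof -
          have "norm ((B (\<sigma> t) - B (\<gamma> w t)) *v v) \<le> norm (B (\<sigma> t) - B (\<gamma> w t)) * norm v * C"
            by (rule C(2))
          also have "\<dots> \<le> (L * (C * b * norm v)) * norm v * C"
          proof (intro mult_right_mono)
            have "norm (B (\<sigma> t) - B (\<gamma> w t)) \<le> L * norm u"
              using L(2)[OF \<gamma>K[OF w t] \<sigma>K[OF t]] by (simp add: \<sigma>\<gamma>)
            also have "\<dots> \<le> L * (C * b * norm v)" using u L(1) by (rule mult_left_mono)
            finally show "norm (B (\<sigma> t) - B (\<gamma> w t)) \<le> L * (C * b * norm v)" .
          qed (use C in auto)
          also have "\<dots> = (norm v * (M * L)) * norm v" by (simp add: M_def ac_simps)
          also have "\<dots> \<le> (d' * (M * L)) * norm v"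
            using v(1) MLnn by (intro mult_right_mono) auto
          also have "\<dots> \<le> \<eta> / 4 * norm v" using d'(4) by (rule mult_right_mono) simp
          finally show ?thesis .
        qed
        have 3: "norm ((B (\<sigma> t) - B (\<gamma> w t) - DB t u) *v w) \<le> \<eta> / 4 * norm v"
        proof -
          have "norm v * (C * b) < d' * (C * b)" using v(1) C b by simp
          then have "norm u < d" using u d'(3) by (simp add: ac_simps)
          then have Bu: "norm (B (\<sigma> t) - B (\<gamma> w t) - DB t u) \<le> \<epsilon> * norm u"
            using d(2)[OF \<gamma>K[OF w t] \<sigma>K[OF t]] unfolding \<sigma>\<gamma> DB_def by blast
          have "norm ((B (\<sigma> t) - B (\<gamma> w t) - DB t u) *v w) \<le> norm (B (\<sigma> t) - B (\<gamma> w t) - DB t u) * norm w * C"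
            by (rule C(2))
          also have "\<dots> \<le> (\<epsilon> * (C * b * norm v)) * \<delta> * C"
          proof (intro mult_right_mono mult_mono)
            have "\<epsilon> * norm u \<le> \<epsilon> * (C * b * norm v)" using u \<epsilon> by (intro mult_left_mono) auto
            with Bu show "norm (B (\<sigma> t) - B (\<gamma> w t) - DB t u) \<le> \<epsilon> * (C * b * norm v)" by linarith
          qed (use w C b \<epsilon> in auto)
          also have "\<dots> = (\<epsilon> * (M * \<delta>)) * norm v" by (simp add: M_def ac_simps)
          also have "\<epsilon> * (M * \<delta>) = \<eta> / 4" using M \<delta>(1) by (simp add: \<epsilon>_def)
          finally show ?thesis .
        qed
        have "norm (e' t) \<le> norm ((Bt (\<gamma> z t) - Bt (\<sigma> t)) *v z) + norm ((B (\<sigma> t) - B (\<gamma> w t)) *v v)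
            + norm ((B (\<sigma> t) - B (\<gamma> w t) - DB t u) *v w)"
          unfolding e'_eq by (intro order_trans[OF norm_triangle_ineq] add_right_mono norm_triangle_ineq)
        then show ?thesis using 1 2 3 by linarith
      qed
      have e0: "e 0 = 0" using \<gamma>0[OF z\<delta>] \<gamma>0[OF w] by (simp add: e_def \<sigma>_def)
      have "norm (e t0 - e 0) \<le> (S / 2 + \<eta> / 2 * norm v) * (t0 - 0)"
      proof (rule vector_derivative_norm_bound[where f'=e'])
        show "(e has_vector_derivative e' s) (at s within {0..t0})" if "s \<in> {0..t0}" for s
          by (rule has_vector_derivative_within_subset[OF e_deriv]) (use t0(1) that in auto)
        show "norm (e' s) \<le> S / 2 + \<eta> / 2 * norm v" if "s \<in> {0..t0}" for s
          using e'_bound t0(1) that by auto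
      qed (use t0(1) in auto)
      also have "\<dots> \<le> S / 2 + \<eta> / 2 * norm v"
        using t0(1) \<eta> by (intro mult_left_le) (auto simp: S_def)
      finally have "S \<le> \<eta> * norm v" unfolding e0 S_def by simp
      moreover have "norm (e 1) \<le> S" unfolding S_def by (rule t0(2)) simp
      ultimately have "norm (e 1) \<le> \<eta> * norm v" by linarith
      moreover have "e 1 = f z - f w - B (f w) *v (z - w)"
        by (simp add: e_def \<sigma>_def f_def v_def)
      ultimately show ?thesis by (simp add: v_def)
    qed
    then show "\<exists>d>0. \<forall>z. norm (z - w) < d \<longrightarrow> norm (f z - f w - B (f w) *v (z - w)) \<le> \<eta> * norm (z - w)"
      using d'(1) by blast
  qed
  moreover have "f w \<in> U" if "norm w < \<delta>" for w
    unfolding f_def using \<gamma>K[OF that] K(3) by auto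
  moreover have "f 0 = x0" using dist\<gamma>[of 0 1] \<delta>(1) by (simp add: f_def)
  ultimately show ?thesis
    using \<delta>(1) by (intro exI[of _ \<delta>] conjI exI[of _ f]) auto
qed

section \<open>The local Frobenius theorem\<close>

lemma projection_bracket:
  fixes l :: "real^'n \<Rightarrow> real^'n^'n"
  assumes "open U" "x \<in> U" and l': "(l has_derivative l') (at x)"
    and Z': "(Z has_derivative Z') (at x)" and W': "(W has_derivative W') (at x)"
    and Z0: "\<And>y. y \<in> U \<Longrightarrow> l y *v Z y = 0" and W0: "\<And>y. y \<in> U \<Longrightarrow> l y *v W y = 0"
  shows "l x *v (W' (Z x) - Z' (W x)) = l' (W x) *v Z x - l' (Z x) *v W x"
proof -
  have *: "l x *v Y' h + l' h *v Y x = 0"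
    if Y': "(Y has_derivative Y') (at x)" and Y0: "\<And>y. y \<in> U \<Longrightarrow> l y *v Y y = 0" for Y Y' h
  proof -
    have "((\<lambda>y. l y *v Y y) has_derivative (\<lambda>h. l x *v Y' h + l' h *v Y x)) (at x)"
      by (rule bounded_bilinear.FDERIV[OF bounded_bilinear_matrix_vector l' Y'])
    moreover have "((\<lambda>y. l y *v Y y) has_derivative (\<lambda>h. 0)) (at x)"
      by (rule has_derivative_transform_within_open[OF has_derivative_const assms(1,2)]) (simp add: Y0)
    ultimately have "(\<lambda>h. l x *v Y' h + l' h *v Y x) = (\<lambda>h. 0)"
      by (rule has_derivative_unique)
    then show ?thesis by metis
  qed
  show ?thesis
    using *[OF Z' Z0, of "W x"] *[OF W' W0, of "Z x"]
    by (simp add: matrix_vector_mult_diff_distrib algebra_simps add_eq_0_iff)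
qed

text \<open>Differentiating the tangency relation for \<open>v\<close> in the direction
  \<open>w\<close> produces a second derivative of \<open>g\<close>, which is symmetric and cancels
  when the roles are exchanged. The relation is only available on \<open>S\<close>, which is
  relatively open in \<open>E\<close>, so the differentiation runs along lines
  \<open>s0 + t w\<close> inside \<open>E\<close>.\<close>

lemma integral_map_symmetric:
  fixes l :: "real^'n \<Rightarrow> real^'n^'n" and g :: "real^'k \<Rightarrow> real^'n"
  assumes "open W" "s0 \<in> W" and g: "Ck_on (Suc (Suc k)) W g"
    and l': "(l has_derivative l') (at (g s0))"
    and E: "subspace E" "openin (top_of_set E) S" "s0 \<in> S"
    and tangent: "\<And>s w. s \<in> S \<inter> W \<Longrightarrow> w \<in> E \<Longrightarrow> l (g s) *v frechet_derivative g (at s) w = 0"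
    and "v \<in> E" "w \<in> E"
  shows "l' (frechet_derivative g (at s0) w) *v frechet_derivative g (at s0) v =
    l' (frechet_derivative g (at s0) v) *v frechet_derivative g (at s0) w"
proof -
  define g' where "g' s = frechet_derivative g (at s)" for s
  define A where "A v = frechet_derivative (\<lambda>s. g' s v) (at s0)" for v
  have gd: "(g has_derivative g' s) (at s)" if "s \<in> W" for s
    unfolding g'_def by (rule Ck_on_imp_has_derivative[OF g that])
  have "Ck_on (Suc k) W (\<lambda>s. g' s v)" for v using g by (simp add: g'_def)
  then have Ad: "((\<lambda>s. g' s v) has_derivative A v) (at s0)" for v
    unfolding A_def using Ck_on_imp_has_derivative assms(2) by blast
  have sym: "A v w = A w v" for v w
    by (rule second_derivative_symmetric[OF assms(1,2) gd Ad Ad])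
  obtain T where T: "open T" "S = E \<inter> T" using E(2) openin_open by metis
  have key: "l (g s0) *v A v w + l' (g' s0 w) *v g' s0 v = 0" if "v \<in> E" "w \<in> E" for v w
  proof -
    have line: "((\<lambda>t. s0 + t *\<^sub>R w) has_derivative (\<lambda>t. t *\<^sub>R w)) (at (0::real))"
      by (auto intro!: derivative_eq_intros)
    have "((\<lambda>t. l (g (s0 + t *\<^sub>R w)) *v g' (s0 + t *\<^sub>R w) v) has_derivative
        (\<lambda>t. l (g s0) *v A v (t *\<^sub>R w) + l' (g' s0 (t *\<^sub>R w)) *v g' s0 v)) (at 0)"
    proof (rule bounded_bilinear.FDERIV[OF bounded_bilinear_matrix_vector, THEN has_derivative_eq_rhs])
      show "((\<lambda>t. l (g (s0 + t *\<^sub>R w))) has_derivative (\<lambda>t. l' (g' s0 (t *\<^sub>R w)))) (at 0)"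
        using diff_chain_at[OF diff_chain_at[OF line, of g "g' s0"], of l l'] gd[OF assms(2)] l'
        by (simp add: o_def)
      show "((\<lambda>t. g' (s0 + t *\<^sub>R w) v) has_derivative (\<lambda>t. A v (t *\<^sub>R w))) (at 0)"
        using diff_chain_at[OF line, of "\<lambda>s. g' s v" "A v"] Ad by (simp add: o_def)
    qed simp
    moreover have "((\<lambda>t. l (g (s0 + t *\<^sub>R w)) *v g' (s0 + t *\<^sub>R w) v) has_derivative (\<lambda>t. 0)) (at 0)"
    proof (rule has_derivative_transform_within_open[OF has_derivative_const])
      have "continuous_on UNIV (\<lambda>t::real. s0 + t *\<^sub>R w)" by (intro continuous_intros)
      then show "open ((\<lambda>t::real. s0 + t *\<^sub>R w) -` (T \<inter> W))"
        using T(1) assms(1) by (intro open_vimage) auto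
      show "0 \<in> (\<lambda>t::real. s0 + t *\<^sub>R w) -` (T \<inter> W)" using E(3) T assms(2) by auto
      fix t assume "t \<in> (\<lambda>t::real. s0 + t *\<^sub>R w) -` (T \<inter> W)"
      moreover have "s0 + t *\<^sub>R w \<in> E" using E(1,3) T that by (auto simp: subspace_add subspace_scale)
      ultimately show "0 = l (g (s0 + t *\<^sub>R w)) *v g' (s0 + t *\<^sub>R w) v"
        unfolding g'_def using tangent[of "s0 + t *\<^sub>R w" v] T that by simp
    qed
    ultimately have "(\<lambda>t. l (g s0) *v A v (t *\<^sub>R w) + l' (g' s0 (t *\<^sub>R w)) *v g' s0 v) = (\<lambda>t. 0)"
      by (rule has_derivative_unique)
    from fun_cong[OF this, of 1] show ?thesis by simp
  qed
  show ?thesis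
    using key[OF assms(9,10)] key[OF assms(10,9)] unfolding sym[of v w] g'_def[symmetric]
    by (metis add_left_cancel)
qed

text \<open>Each clause supplies one property of the integral manifold. The relation for
  \<open>f w - x0\<close> makes \<open>m0\<close> a left inverse of the parametrization on
  \<open>im m0\<close>; the relation for \<open>m0 *v D w v\<close> makes \<open>D w\<close>
  injective there; the two clauses about the kernel of \<open>l (f w)\<close> identify that kernel
  with the image of \<open>im m0\<close> under \<open>D w\<close>.\<close>

lemma frobenius_local:
  fixes l :: "real^'n \<Rightarrow> real^'n^'n"
  assumes "open U" "x0 \<in> U" and Cl: "\<And>k. Ck_on k U l"
    and idem: "\<And>x. x \<in> U \<Longrightarrow> l x ** l x = l x"
    and sym: "\<And>x u v. x \<in> U \<Longrightarrow> l x *v u = 0 \<Longrightarrow> l x *v v = 0 \<Longrightarrow>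
      frechet_derivative l (at x) u *v v = frechet_derivative l (at x) v *v u"
  defines "m0 \<equiv> mat 1 - l x0"
  shows "\<exists>\<delta>>0. \<exists>f D. f 0 = x0 \<and> (\<forall>k. Ck_on k (ball 0 \<delta>) f) \<and>
    (\<forall>w\<in>ball 0 \<delta>. f w \<in> U \<and> m0 *v (f w - x0) = m0 *v w \<and> (f has_derivative D w) (at w) \<and>
      (\<forall>v. m0 *v D w v = m0 *v v \<and> l (f w) *v D w v = 0) \<and>
      (\<forall>u. l (f w) *v u = 0 \<longrightarrow> D w (m0 *v u) = u))"
proof -
  define l0 where "l0 = l x0"
  define m where "m x = mat 1 - l x" for x
  \<comment> \<open>\<open>G x\<^sub>0 = 1\<close>, and \<open>G\<close> intertwines \<open>m\<close> with \<open>m0\<close>, so near \<open>x\<^sub>0\<close> it identifies \<open>ker (l x)\<close> with \<open>ker (l x\<^sub>0)\<close>.\<close>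
  define G where "G x = m0 ** m x + l0 ** l x" for x
  have l0: "l0 ** l0 = l0" using idem assms(2) by (simp add: l0_def)
  have m0: "m0 ** m0 = m0" "m0 ** l0 = 0"
    using l0 unfolding m0_def l0_def[symmetric]
    by (simp_all add: matrix_diff_left matrix_diff_right)
  have lm: "l x ** m x = 0" "m x ** m x = m x" if "x \<in> U" for x
    using idem[OF that] unfolding m_def by (simp_all add: matrix_diff_left matrix_diff_right)
  have CG: "Ck_on k U G" for k
  proof -
    have "Ck_on k U (\<lambda>x. mat 1 + (- 1) *\<^sub>R l x)"
      by (intro Ck_on_add Ck_on_const Ck_on_linear_comp[OF bounded_linear_scaleR_right] assms(1) Cl)
    then have "Ck_on k U m" by (simp add: m_def[abs_def])
    then show ?thesis unfolding G_def[abs_def]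
      by (intro Ck_on_add assms(1) Cl Ck_on_bilinear[OF bounded_bilinear_matrix_matrix] Ck_on_const)
  qed
  define V where "V = {x \<in> U. det (G x) \<noteq> 0}"
  have "continuous_on U (\<lambda>x. det (G x))"
    by (rule Ck_on_imp_continuous[of 0], rule Ck_on_det[OF assms(1)],
        rule Ck_on_linear_comp[OF bounded_linear_vec_nth2 assms(1) CG])
  then have "open (U \<inter> (\<lambda>x. det (G x)) -` (- {0}))"
    using assms(1) by (intro continuous_open_preimage) auto
  then have V: "open V" "V \<subseteq> U" by (auto simp: V_def vimage_def Int_def conj_commute)
  have "G x0 = mat 1"
  proof -
    have "G x0 = m0 ** m0 + l0 ** l0" unfolding G_def m_def m0_def l0_def ..
    also have "\<dots> = mat 1" unfolding m0(1) l0 by (simp add: m0_def l0_def)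
    finally show ?thesis .
  qed
  then have x0V: "x0 \<in> V" using assms(2) by (simp add: V_def det_I)
  define B where "B x = matrix_inv (G x) ** m0" for x
  have CB: "Ck_on k V B" for k
    unfolding B_def
    by (intro Ck_on_bilinear[OF bounded_bilinear_matrix_matrix] V Ck_on_const Ck_on_matrix_inv
        Ck_on_subset[OF CG V(2)]) (simp add: V_def)
  have GI: "matrix_inv (G x) ** G x = mat 1" "G x ** matrix_inv (G x) = mat 1" if "x \<in> V" for x
  proof -
    have "invertible (G x)" using that by (simp add: V_def invertible_det_nz)
    then show "matrix_inv (G x) ** G x = mat 1" "G x ** matrix_inv (G x) = mat 1"
      by (rule matrix_inv_left, rule matrix_inv_right)
  qed
  have Gm: "G x ** m x = m0 ** m x" "m0 ** G x = m0 ** m x" if "x \<in> V" for x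
  proof -
    have x: "x \<in> U" using that V by blast
    show "G x ** m x = m0 ** m x"
      by (simp add: G_def matrix_add_left matrix_mul_assoc[symmetric] lm[OF x])
    show "m0 ** G x = m0 ** m x"
      by (simp add: G_def matrix_add_right matrix_mul_assoc m0)
  qed
  \<comment> \<open>The intertwining relation moves the projection to the other side of the inverse
    of \<open>G x\<close>. In this form the image of \<open>B x\<close> visibly lies in the image of
    \<open>m x\<close>, that is, in the kernel of \<open>l x\<close>.\<close>
  have Bm: "B x = m x ** matrix_inv (G x)" if "x \<in> V" for x
  proof -
    have "B x = matrix_inv (G x) ** (m0 ** G x) ** matrix_inv (G x)"
      unfolding B_def matrix_mul_assoc[symmetric] GI[OF that] by simp
    also have "m0 ** G x = G x ** m x" using Gm[OF that] by simp
    also have "matrix_inv (G x) ** (G x ** m x) = m x"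
      unfolding matrix_mul_assoc GI[OF that] by simp
    finally show ?thesis .
  qed
  have lB: "l x ** B x = 0" if "x \<in> V" for x
    unfolding Bm[OF that] matrix_mul_assoc using lm that V by auto
  have m0B: "m0 ** B x = m0" if "x \<in> V" for x
    unfolding Bm[OF that] matrix_mul_assoc Gm(2)[OF that, symmetric]
    unfolding matrix_mul_assoc[symmetric] GI[OF that] by simp
  have Bu: "B x *v (m0 *v u) = u" if x: "x \<in> V" and u: "l x *v u = 0" for x u
  proof -
    have "m x *v u = u" using u by (simp add: m_def matrix_vector_mult_diff_rdistrib)
    then have "G x *v u = m0 *v u"
      unfolding G_def by (simp add: matrix_vector_mult_add_rdistrib matrix_vector_mul_assoc[symmetric] u)
    then have "u = matrix_inv (G x) *v (m0 *v u)"
      using GI(1)[OF x] by (metis matrix_vector_mul_assoc matrix_vector_mul_lid)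
    also have "m0 *v u = m0 *v (m0 *v u)" by (simp add: matrix_vector_mul_assoc m0)
    finally show ?thesis unfolding B_def by (simp only: matrix_vector_mul_assoc matrix_mul_assoc)
  qed
  have int: "frechet_derivative B (at x) (B x *v w) *v v = frechet_derivative B (at x) (B x *v v) *v w"
    if x: "x \<in> V" for x v w
  proof -
    define B' l' where "B' = frechet_derivative B (at x)" and "l' = frechet_derivative l (at x)"
    have B': "(B has_derivative B') (at x)"
      unfolding B'_def using Ck_on_imp_has_derivative[OF CB x] .
    have l': "(l has_derivative l') (at x)"
      unfolding l'_def using Ck_on_imp_has_derivative[OF Cl] x V by blast
    have "((\<lambda>y. l y ** B y) has_derivative (\<lambda>h. l x ** B' h + l' h ** B x)) (at x)"
      by (rule bounded_bilinear.FDERIV[OF bounded_bilinear_matrix_matrix l' B'])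
    moreover have "((\<lambda>y. l y ** B y) has_derivative (\<lambda>h. 0)) (at x)"
      by (rule has_derivative_transform_within_open[OF has_derivative_const V(1) x]) (simp add: lB)
    ultimately have "(\<lambda>h. l x ** B' h + l' h ** B x) = (\<lambda>h. 0)"
      by (rule has_derivative_unique)
    then have 1: "l x ** B' h + l' h ** B x = 0" for h by (rule fun_cong)
    have "((\<lambda>y. m0 ** B y) has_derivative (\<lambda>h. m0 ** B' h)) (at x)"
      by (rule bounded_linear.has_derivative[OF
            bounded_bilinear.bounded_linear_right[OF bounded_bilinear_matrix_matrix] B'])
    moreover have "((\<lambda>y. m0 ** B y) has_derivative (\<lambda>h. 0)) (at x)"
      by (rule has_derivative_transform_within_open[OF has_derivative_const V(1) x]) (simp add: m0B)
    ultimately have "(\<lambda>h. m0 ** B' h) = (\<lambda>h. 0)"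
      by (rule has_derivative_unique)
    then have 2: "m0 ** B' h = 0" for h by (rule fun_cong)
    \<comment> \<open>By \<open>Bu\<close>, a vector in the kernel of \<open>l x\<close> is
      determined by its image under \<open>m0\<close>. Differentiating \<open>l ** B = 0\<close>
      together with the symmetry hypothesis puts \<open>z\<close> into that kernel, and
      differentiating the constant \<open>m0 ** B\<close> shows that \<open>m0\<close> kills
      it.\<close>
    define z where "z = B' (B x *v w) *v v - B' (B x *v v) *v w"
    have lB': "l x *v (B' h *v u) = - (l' h *v (B x *v u))" for h u
    proof -
      have "(l x ** B' h + l' h ** B x) *v u = 0" unfolding 1 by simp
      then show ?thesis
        by (simp add: matrix_vector_mult_add_rdistrib matrix_vector_mul_assoc eq_neg_iff_add_eq_0)
    qed
    have "l x *v (B x *v u) = 0" for u by (simp add: matrix_vector_mul_assoc lB[OF x])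
    then have "l' (B x *v w) *v (B x *v v) = l' (B x *v v) *v (B x *v w)"
      unfolding l'_def using sym x V(2) by blast
    then have "l x *v z = 0"
      unfolding z_def by (simp add: matrix_vector_mult_diff_distrib lB')
    moreover have "m0 *v z = 0"
      unfolding z_def by (simp add: matrix_vector_mult_diff_distrib matrix_vector_mul_assoc 2)
    ultimately have "z = 0" using Bu[OF x, of z] by simp
    then show ?thesis by (simp add: z_def B'_def)
  qed
  obtain \<delta> f where \<delta>: "\<delta> > 0" "f 0 = x0" and f: "\<And>w. w \<in> ball 0 \<delta> \<Longrightarrow> f w \<in> V"
    "\<And>w. w \<in> ball 0 \<delta> \<Longrightarrow> (f has_derivative (\<lambda>v. B (f w) *v v)) (at w)"
    using total_differential_equation[OF V(1) x0V CB int] by blast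
  \<comment> \<open>Bootstrapping: the derivative of \<open>f\<close> is \<open>B\<close> composed
    with \<open>f\<close>, so each order of smoothness of \<open>f\<close> yields the next.\<close>
  have Cf: "Ck_on k (ball 0 \<delta>) f" for k
  proof (induction k)
    case 0
    have "isCont f w" if "w \<in> ball 0 \<delta>" for w
      using f(2)[OF that] by (rule has_derivative_continuous)
    then show ?case by (simp add: continuous_at_imp_continuous_on)
  next
    case (Suc k)
    show ?case
    proof (rule Ck_on_SucI[where D="\<lambda>w v. B (f w) *v v"])
      show "Ck_on k (ball 0 \<delta>) (\<lambda>w. B (f w) *v v)" for v
        by (intro Ck_on_bilinear[OF bounded_bilinear_matrix_vector] Ck_on_const
            Ck_on_compose[OF _ CB Suc] open_ball) (use f(1) in blast)
    qed (use f(2) in auto)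
  qed
  have f0: "m0 *v (f w - x0) = m0 *v w" if w: "w \<in> ball 0 \<delta>" for w
  proof -
    define q where "q w = m0 *v f w - m0 *v w" for w
    have q': "(q has_derivative (\<lambda>v. 0)) (at w within ball 0 \<delta>)" if w: "w \<in> ball 0 \<delta>" for w
    proof -
      have "(q has_derivative (\<lambda>v. m0 *v (B (f w) *v v) - m0 *v v)) (at w within ball 0 \<delta>)"
        unfolding q_def
        by (intro has_derivative_diff bounded_linear.has_derivative[OF matrix_vector_mul_bounded_linear]
            has_derivative_at_withinI[OF f(2)[OF w]] has_derivative_ident)
      then show ?thesis by (simp add: matrix_vector_mul_assoc m0B[OF f(1)[OF w]])
    qed
    have "q w = q 0"
      by (rule has_derivative_zero_unique[OF convex_ball q' w]) (use \<delta>(1) in simp_all)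
    then show ?thesis by (simp add: q_def \<delta>(2) matrix_vector_mult_diff_distrib algebra_simps)
  qed
  have fB: "m0 *v (B (f w) *v v) = m0 *v v" "l (f w) *v (B (f w) *v v) = 0" if "w \<in> ball 0 \<delta>" for w v
    using m0B lB f(1)[OF that] by (simp_all add: matrix_vector_mul_assoc)
  show ?thesis
  proof (intro exI[of _ \<delta>] exI[of _ f] exI[of _ "\<lambda>w v. B (f w) *v v"] conjI ballI allI impI)
    fix w :: "real^'n" assume w: "w \<in> ball 0 \<delta>"
    show "f w \<in> U" using f(1)[OF w] V(2) by blast
    show "B (f w) *v (m0 *v u) = u" if "l (f w) *v u = 0" for u
      using Bu[OF f(1)[OF w] that] .
  qed (fact \<delta> Cf f f0 fB)+
qed

section \<open>A smooth bump function\<close>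

text \<open>For \<open>n = 0\<close> this is the classical flat function. The powers of
  \<open>1 / t\<close> are included because they arise on differentiation: the span of the whole
  family is closed under it, so one induction proves smoothness for all \<open>n\<close>.\<close>

definition flat_exp :: "nat \<Rightarrow> real \<Rightarrow> real" where
  "flat_exp n t = (if t > 0 then inverse t ^ n * exp (- inverse t) else 0)"

lemma flat_exp_tendsto_0: "(flat_exp n \<longlongrightarrow> 0) (at 0)"
proof -
  have "((\<lambda>t. inverse t ^ n / exp (inverse t)) \<longlongrightarrow> 0) (at_right (0::real))"
    by (rule filterlim_compose[OF tendsto_power_div_exp_0 filterlim_inverse_at_top_right])
  then have "(flat_exp n \<longlongrightarrow> 0) (at_right 0)"
    by (rule tendsto_cong[THEN iffD1, rotated])
      (auto simp: flat_exp_def exp_minus divide_inverse eventually_at_right_less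
        intro!: eventually_mono[OF eventually_at_right_less])
  moreover have "(flat_exp n \<longlongrightarrow> 0) (at_left 0)"
    by (rule tendsto_cong[THEN iffD1, OF _ tendsto_const])
      (auto simp: flat_exp_def eventually_at_filter)
  ultimately show ?thesis by (simp add: filterlim_at_split)
qed

lemma DERIV_flat_exp:
  "(flat_exp n has_real_derivative flat_exp (n + 2) t - real n * flat_exp (n + 1) t) (at t)"
proof (cases t "0::real" rule: linorder_cases)
  case less
  have "((\<lambda>t. 0) has_real_derivative 0) (at t)" by simp
  then have "(flat_exp n has_real_derivative 0) (at t)"
    by (rule has_field_derivative_transform_within_open[where S="{..<0}"])
      (use less in \<open>auto simp: flat_exp_def\<close>)
  then show ?thesis using less by (simp add: flat_exp_def)
next
  case equal
  \<comment> \<open>Away from 0 the difference quotient at 0 is the next member of the family, which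
    is already known to tend to 0.\<close>
  have "((\<lambda>h. (flat_exp n (0 + h) - flat_exp n 0) / h) \<longlongrightarrow> 0) (at 0)"
    by (rule tendsto_cong[THEN iffD1, OF _ flat_exp_tendsto_0[of "Suc n"]])
      (auto simp: flat_exp_def eventually_at_filter divide_inverse)
  then have "(flat_exp n has_real_derivative 0) (at 0)" by (simp add: DERIV_def)
  then show ?thesis using equal by (simp add: flat_exp_def)
next
  case greater
  have "((\<lambda>t. inverse t ^ n * exp (- inverse t)) has_real_derivative
      flat_exp (n + 2) t - real n * flat_exp (n + 1) t) (at t)"
    using greater
    by (auto intro!: derivative_eq_intros simp: flat_exp_def power2_eq_square)
      (cases n; simp add: field_simps)
  then show ?thesis
    by (rule has_field_derivative_transform_within_open[where S="{0<..}"])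
      (use greater in \<open>auto simp: flat_exp_def\<close>)
qed

lemma Ck_on_flat_exp: "Ck_on k UNIV (flat_exp n)"
proof (induction k arbitrary: n)
  case 0
  have "isCont (flat_exp n) t" for t using DERIV_isCont[OF DERIV_flat_exp] .
  then show ?case by (simp add: continuous_at_imp_continuous_on)
next
  case (Suc k)
  show ?case
  proof (rule Ck_on_SucI[where D="\<lambda>t v. v * (flat_exp (n + 2) t + (- real n) * flat_exp (n + 1) t)"])
    show "(flat_exp n has_derivative (\<lambda>v. v * (flat_exp (n + 2) t + (- real n) * flat_exp (n + 1) t))) (at t)" for t
      using DERIV_flat_exp[of n t] by (simp add: has_field_derivative_def mult_commute_abs)
    show "Ck_on k UNIV (\<lambda>t. v * (flat_exp (n + 2) t + (- real n) * flat_exp (n + 1) t))" for v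
      by (intro Ck_on_linear_comp[OF bounded_linear_mult_right] Ck_on_add Suc open_UNIV)
  qed simp
qed

lemma smooth_bump:
  fixes x :: "'a::euclidean_space"
  assumes "R > 0"
  shows "\<exists>b::'a \<Rightarrow> real. (\<forall>k. Ck_on k UNIV b) \<and> b x = 1 \<and> (\<forall>y. dist x y \<ge> R \<longrightarrow> b y = 0)"
proof -
  \<comment> \<open>This is \<open>R^2 - (norm (y - x))^2\<close>, positive exactly inside the ball
    of radius \<open>R\<close>; it is written with sums and scalings to match the closure rules of
    \<open>Ck_on\<close>.\<close>
  define q where "q y = R\<^sup>2 + (- 1) *\<^sub>R ((y + - x) \<bullet> (y + - x))" for y
  define b where "b y = inverse (flat_exp 0 (R\<^sup>2)) * flat_exp 0 (q y)" for y
  have "Ck_on k UNIV (\<lambda>y. y + - x)" for k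
    by (intro Ck_on_add Ck_on_const Ck_on_linear bounded_linear_ident open_UNIV)
  then have q: "Ck_on k UNIV q" for k
    unfolding q_def
    by (intro Ck_on_add[OF open_UNIV Ck_on_const] Ck_on_linear_comp[OF bounded_linear_scaleR_right open_UNIV]
        Ck_on_bilinear[OF bounded_bilinear_inner open_UNIV])
  have "Ck_on k UNIV b" for k
    unfolding b_def
    by (intro Ck_on_linear_comp[OF bounded_linear_mult_right open_UNIV]
        Ck_on_compose[OF open_UNIV Ck_on_flat_exp q]) simp
  moreover have "b x = 1" using assms by (simp add: b_def q_def flat_exp_def)
  moreover have "b y = 0" if "dist x y \<ge> R" for y
  proof -
    have "R\<^sup>2 \<le> (norm (y - x))\<^sup>2" using that assms by (intro power_mono) (auto simp: dist_norm norm_minus_commute)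
    then have "q y \<le> 0" by (simp add: q_def power2_norm_eq_inner)
    then show ?thesis by (simp add: b_def flat_exp_def)
  qed
  ultimately show ?thesis by blast
qed

section \<open>The real projection of an \<open>F\<close>-structure\<close>

lemma mat_power_0 [simp]: "mat_power A 0 = mat 1"
  by (simp add: mat_power_def)

lemma mat_power_Suc: "mat_power A (Suc k) = A ** mat_power A k"
  by (simp add: mat_power_def)

text \<open>With \<open>J\<close> the Jacobian of a change of charts, this carries the
  transformation law of a tensor over to its powers; with \<open>A' = J = A\<close> it says that a
  matrix commutes with its powers.\<close>

lemma mat_power_intertwine:
  fixes A A' J :: "'a::semiring_1^'n^'n"
  assumes "A' ** J = J ** A"
  shows "mat_power A' k ** J = J ** mat_power A k"
proof (induction k)
  case (Suc k)
  have "mat_power A' (Suc k) ** J = A' ** (mat_power A' k ** J)"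
    by (simp only: mat_power_Suc matrix_mul_assoc)
  also have "\<dots> = (A' ** J) ** mat_power A k" by (simp only: Suc matrix_mul_assoc)
  also have "\<dots> = J ** mat_power A (Suc k)" by (simp only: assms mat_power_Suc matrix_mul_assoc)
  finally show ?case .
qed simp

lemma mat_power_Suc2: "mat_power A (Suc k) = mat_power A k ** A"
  using mat_power_intertwine[of A A A k] by (simp add: mat_power_Suc)

lemma Ck_on_mat_power:
  fixes A :: "'a::real_normed_vector \<Rightarrow> real^'n^'n"
  assumes "open U" "Ck_on j U A"
  shows "Ck_on j U (\<lambda>x. mat_power (A x) k)"
proof (induction k)
  case (Suc k)
  show ?case
    unfolding mat_power_Suc by (rule Ck_on_bilinear[OF bounded_bilinear_matrix_matrix assms Suc])
qed simp

lemma complexify_matrix_mult: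
  "map_matrix complex_of_real (A ** B) = map_matrix complex_of_real A ** map_matrix complex_of_real B"
  by (simp add: vec_eq_iff matrix_matrix_mult_def)

lemma complexify_mat_power:
  "mat_power (map_matrix complex_of_real A) k = map_matrix complex_of_real (mat_power A k)"
proof (induction k)
  case 0
  show ?case by (simp add: vec_eq_iff mat_def)
next
  case (Suc k)
  then show ?case by (simp only: mat_power_Suc complexify_matrix_mult)
qed

lemma mat_matrix_mult_nth: "(mat a ** (A::'a::comm_semiring_1^'n^'m)) $ i $ j = a * A $ i $ j"
proof -
  have "(mat a ** A) $ i $ j = (\<Sum>k\<in>UNIV. if i = k then a * A $ k $ j else 0)"
    unfolding matrix_matrix_mult_def mat_def vec_lambda_beta by (rule sum.cong) auto
  then show ?thesis by simp
qed

text \<open>The imaginary part \<open>q\<close> of \<open>\<alpha> A\<^sup>K + \<beta> A\<^sup>K\<^sup>-\<^sup>1\<close> satisfies \<open>q A = 0\<close> and is itself divisible by \<open>A\<close>, on whose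
  image the real part acts as \<open>-1\<close>; hence \<open>q = 0\<close>.\<close>

lemma structure_projection:
  fixes A :: "real^'n^'n"
  assumes "K \<ge> 2"
    and eq: "mat \<alpha> ** mat_power (map_matrix complex_of_real A) (K + 1)
      + mat \<beta> ** mat_power (map_matrix complex_of_real A) K
      + mat_power (map_matrix complex_of_real A) 1 = 0"
  defines "P \<equiv> - (Re \<alpha> *\<^sub>R mat_power A K + Re \<beta> *\<^sub>R mat_power A (K - 1))"
  shows "P ** P = P"
    and "- (mat \<alpha> ** mat_power (map_matrix complex_of_real A) K
      + mat \<beta> ** mat_power (map_matrix complex_of_real A) (K - 1)) = map_matrix complex_of_real P"
proof -
  obtain j where K: "K = Suc (Suc j)" using assms(1) by (metis Suc_1 Suc_le_D add_2_eq_Suc le_iff_add)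
  have entry: "\<alpha> * complex_of_real (mat_power A (Suc K) $ i $ k) + \<beta> * complex_of_real (mat_power A K $ i $ k)
      + complex_of_real (A $ i $ k) = 0" for i k
  proof -
    have "(mat \<alpha> ** mat_power (map_matrix complex_of_real A) (K + 1)
      + mat \<beta> ** mat_power (map_matrix complex_of_real A) K
      + mat_power (map_matrix complex_of_real A) 1) $ i $ k = 0" unfolding eq by simp
    then show ?thesis
      unfolding complexify_mat_power vector_add_component mat_matrix_mult_nth
      by (simp add: mat_power_Suc)
  qed
  define Q where "Q = Im \<alpha> *\<^sub>R mat_power A K + Im \<beta> *\<^sub>R mat_power A (K - 1)"
  have "Re (\<alpha> * complex_of_real (mat_power A (Suc K) $ i $ k) + \<beta> * complex_of_real (mat_power A K $ i $ k)
      + complex_of_real (A $ i $ k)) = 0" for i k unfolding entry by simp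
  then have "Re \<alpha> *\<^sub>R mat_power A (Suc K) + Re \<beta> *\<^sub>R mat_power A K + A = 0"
    by (simp add: vec_eq_iff)
  then have "- (Re \<alpha> *\<^sub>R mat_power A (Suc K) + Re \<beta> *\<^sub>R mat_power A K) = A"
    by (rule minus_unique)
  moreover have "P ** A = - (Re \<alpha> *\<^sub>R mat_power A (Suc K) + Re \<beta> *\<^sub>R mat_power A K)"
    unfolding P_def K by (simp add: matrix_add_left matrix_scaleR_left matrix_minus_left
      matrix_diff_left mat_power_Suc2)
  ultimately have PA: "P ** A = A" by (simp only:)
  have "Im (\<alpha> * complex_of_real (mat_power A (Suc K) $ i $ k) + \<beta> * complex_of_real (mat_power A K $ i $ k)
      + complex_of_real (A $ i $ k)) = 0" for i k unfolding entry by simp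
  then have "Im \<alpha> *\<^sub>R mat_power A (Suc K) + Im \<beta> *\<^sub>R mat_power A K = 0"
    by (simp add: vec_eq_iff)
  moreover have "A ** Q = Im \<alpha> *\<^sub>R mat_power A (Suc K) + Im \<beta> *\<^sub>R mat_power A K"
    unfolding Q_def K by (simp add: matrix_add_right matrix_scaleR_right mat_power_Suc)
  ultimately have AQ: "A ** Q = 0" by simp
  \<comment> \<open>Since \<open>K - 1\<close> is at least 1, \<open>P\<close> and \<open>Q\<close>
    are combinations of positive powers of \<open>A\<close>, all of which \<open>P\<close> fixes on
    the left. This gives both \<open>P ** P = P\<close> and \<open>P ** Q = Q\<close>.\<close>
  have Ppow: "P ** mat_power A (Suc k) = mat_power A (Suc k)" for k
    by (simp add: mat_power_Suc matrix_mul_assoc PA)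
  show "P ** P = P"
  proof -
    have "P ** P = - (Re \<alpha> *\<^sub>R (P ** mat_power A K) + Re \<beta> *\<^sub>R (P ** mat_power A (K - 1)))"
      by (subst (2) P_def) (simp only: matrix_add_right matrix_scaleR_right matrix_minus_right)
    also have "\<dots> = P" unfolding K diff_Suc_1 Ppow by (simp add: P_def K)
    finally show ?thesis .
  qed
  have "P = - (Re \<alpha> *\<^sub>R mat_power A (K - 1) + Re \<beta> *\<^sub>R mat_power A (K - 2)) ** A"
    unfolding P_def K by (simp add: matrix_add_left matrix_scaleR_left matrix_minus_left
      matrix_diff_left mat_power_Suc2)
  then obtain R where "P = R ** A" by blast
  then have "P ** Q = R ** (A ** Q)" by (simp only: matrix_mul_assoc)
  then have "P ** Q = 0" by (simp add: AQ)
  moreover have "P ** Q = Q"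
    unfolding Q_def K diff_Suc_1 by (simp only: matrix_add_right matrix_scaleR_right Ppow)
  ultimately have "Q = 0" by simp
  then have Q: "Im \<alpha> * mat_power A K $ i $ k + Im \<beta> * mat_power A (K - 1) $ i $ k = 0" for i k
    unfolding Q_def by (simp add: vec_eq_iff)
  show "- (mat \<alpha> ** mat_power (map_matrix complex_of_real A) K
      + mat \<beta> ** mat_power (map_matrix complex_of_real A) (K - 1)) = map_matrix complex_of_real P"
    unfolding complexify_mat_power vec_eq_iff
    using Q by (simp add: mat_matrix_mult_nth P_def complex_eq_iff neg_eq_iff_add_eq_0)
qed

section \<open>Complexification of real vectors and subspaces\<close>

lemma complexify_mult_vec:
  "map_matrix complex_of_real A *v complexify_vec v = complexify_vec (A *v v)"
  by (simp add: vec_eq_iff complexify_vec_def matrix_vector_mult_def)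

lemma complexify_vec_0 [simp]: "complexify_vec 0 = 0"
  by (simp add: complexify_vec_def vec_eq_iff)

lemma complexify_vec_eq_0_iff [simp]: "complexify_vec v = 0 \<longleftrightarrow> v = 0"
  by (simp add: complexify_vec_def vec_eq_iff)

lemma bounded_linear_complexify_vec: "bounded_linear complexify_vec"
proof -
  have "linear complexify_vec"
    by (simp add: linear_iff complexify_vec_def vec_eq_iff complex_eq_iff)
  then show ?thesis by (simp add: linear_conv_bounded_linear)
qed

lemma complexify_vec_split:
  "\<exists>a b. z = complexify_vec a + \<i> *s complexify_vec b"
  by (intro exI[of _ "\<chi> i. Re (z $ i)"] exI[of _ "\<chi> i. Im (z $ i)"])
    (simp add: vec_eq_iff complexify_vec_def complex_eq_iff)

lemma complexify_split_eq_complexify: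
  "complexify_vec u = complexify_vec a + \<i> *s complexify_vec b \<Longrightarrow> u = a"
  by (simp add: vec_eq_iff complexify_vec_def complex_eq_iff)

lemma complexify_mult_split:
  "map_matrix complex_of_real A *v (complexify_vec a + \<i> *s complexify_vec b) =
    complexify_vec (A *v a) + \<i> *s complexify_vec (A *v b)"
  by (simp add: matrix_vector_right_distrib complexify_mult_vec[symmetric] vector_scalar_commute)

text \<open>The kernel of a projection is the image of the complementary one, and a real matrix acts
  on real and imaginary parts separately.\<close>

lemma complexify_kernel:
  fixes P :: "real^'n^'n"
  assumes "P ** P = P"
  shows "complexify_subspace {v. P *v v = 0} = range ((*v) (map_matrix complex_of_real (mat 1 - P)))"
proof -
  have 1: "(mat 1 - P) *v v = v" if "P *v v = 0" for v
    using that by (simp add: matrix_vector_mult_diff_rdistrib)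
  have 2: "P *v ((mat 1 - P) *v v) = 0" for v
    by (simp add: matrix_vector_mult_diff_rdistrib matrix_vector_mult_diff_distrib matrix_vector_mul_assoc assms)
  show ?thesis
  proof (intro set_eqI iffI)
    fix z assume "z \<in> complexify_subspace {v. P *v v = 0}"
    then obtain a b where z: "z = complexify_vec a + \<i> *s complexify_vec b" "P *v a = 0" "P *v b = 0"
      unfolding complexify_subspace_def by blast
    then have "z = map_matrix complex_of_real (mat 1 - P) *v z"
      by (simp only: complexify_mult_split 1)
    then show "z \<in> range ((*v) (map_matrix complex_of_real (mat 1 - P)))" by (rule range_eqI)
  next
    fix z assume "z \<in> range ((*v) (map_matrix complex_of_real (mat 1 - P)))"
    then obtain y where "z = map_matrix complex_of_real (mat 1 - P) *v y" by blast
    moreover obtain a b where "y = complexify_vec a + \<i> *s complexify_vec b"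
      using complexify_vec_split by blast
    ultimately have "z = complexify_vec ((mat 1 - P) *v a) + \<i> *s complexify_vec ((mat 1 - P) *v b)"
      by (simp only: complexify_mult_split)
    then show "z \<in> complexify_subspace {v. P *v v = 0}"
      unfolding complexify_subspace_def using 2 by blast
  qed
qed

section \<open>Charts and vector fields\<close>

lemma manifold_chart:
  assumes "smooth_manifold E M \<A>" "c \<in> \<A>"
  shows "openin M (fst c)"
    and "openin (top_of_set E) (snd c ` fst c)"
    and "homeomorphic_map (subtopology M (fst c)) (top_of_set (snd c ` fst c)) (snd c)"
    and "inj_on (snd c) (fst c)"
proof -
  obtain V \<phi> where c: "c = (V, \<phi>)" by (cases c)
  have "openin M V \<and> openin (top_of_set E) (\<phi> ` V) \<and> homeomorphic_map (subtopology M V) (top_of_set (\<phi> ` V)) \<phi>"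
    using assms unfolding smooth_manifold_def c by blast
  then show o: "openin M (fst c)" and "openin (top_of_set E) (snd c ` fst c)"
    and h: "homeomorphic_map (subtopology M (fst c)) (top_of_set (snd c ` fst c)) (snd c)"
    unfolding c by simp_all
  have "topspace (subtopology M (fst c)) = fst c" using openin_subset[OF o] by auto
  then show "inj_on (snd c) (fst c)" using homeomorphic_imp_injective_map[OF h] by simp
qed

lemma chart_inv [simp]:
  assumes "smooth_manifold E M \<A>" "c \<in> \<A>" "p \<in> fst c"
  shows "inv_into (fst c) (snd c) (snd c p) = p"
  using manifold_chart(4)[OF assms(1,2)] assms(3) by simp

lemma chart_image_openin:
  assumes "smooth_manifold E M \<A>" "c \<in> \<A>" "openin M V"
  shows "openin (top_of_set E) (snd c ` (fst c \<inter> V))"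
proof -
  have "openin (subtopology M (fst c)) (fst c \<inter> V)"
    using assms(3) by (auto simp: openin_subtopology)
  then have "openin (top_of_set (snd c ` fst c)) (snd c ` (fst c \<inter> V))"
    using homeomorphic_imp_open_map[OF manifold_chart(3)[OF assms(1,2)]] by (simp add: open_map_def)
  then show ?thesis using openin_trans manifold_chart(2)[OF assms(1,2)] by blast
qed

lemma chart_inv_continuous:
  assumes "smooth_manifold E M \<A>" "c \<in> \<A>"
  shows "continuous_map (top_of_set (snd c ` fst c)) M (inv_into (fst c) (snd c))"
proof -
  obtain g where g: "homeomorphic_maps (subtopology M (fst c)) (top_of_set (snd c ` fst c)) (snd c) g"
    using manifold_chart(3)[OF assms] homeomorphic_map_maps by blast
  then have "continuous_map (top_of_set (snd c ` fst c)) (subtopology M (fst c)) g"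
    by (simp add: homeomorphic_maps_def)
  then have "continuous_map (top_of_set (snd c ` fst c)) M g"
    by (rule continuous_map_into_fulltopology)
  then show ?thesis
  proof (rule continuous_map_eq)
    fix y assume "y \<in> topspace (top_of_set (snd c ` fst c))"
    then obtain p where p: "p \<in> fst c" "y = snd c p" by auto
    have "p \<in> topspace (subtopology M (fst c))"
      using p openin_subset[OF manifold_chart(1)[OF assms]] by auto
    then have "g (snd c p) = p" using g by (simp add: homeomorphic_maps_def)
    then show "g y = inv_into (fst c) (snd c) y" using p chart_inv[OF assms p(1)] by simp
  qed
qed

section \<open>Transition maps and their Jacobians\<close>

lemma transition_chart:
  assumes "smooth_manifold E M \<A>" "c \<in> \<A>" "p \<in> fst c"
  shows "transition c d (snd c p) = snd d p"
  using chart_inv[OF assms] by (simp add: transition_def)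

lemma transition_smooth:
  assumes "smooth_manifold UNIV M \<A>" "c \<in> \<A>" "d \<in> \<A>"
  shows "open (snd c ` (fst c \<inter> fst d))" and "Ck_on k (snd c ` (fst c \<inter> fst d)) (transition c d)"
proof -
  show o: "open (snd c ` (fst c \<inter> fst d))"
    using chart_image_openin[OF assms(1,2) manifold_chart(1)[OF assms(1,3)]] by simp
  have "smooth_on (snd c ` (fst c \<inter> fst d)) (transition c d)"
    using assms unfolding smooth_manifold_def by blast
  then show "Ck_on k (snd c ` (fst c \<inter> fst d)) (transition c d)"
    using smooth_on_open_iff[OF o] by blast
qed

lemma chart_image_open:
  assumes "smooth_manifold UNIV M \<A>" "c \<in> \<A>"
  shows "open (snd c ` fst c)"
  using manifold_chart(2)[OF assms] by simp

lemma transition_has_derivative: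
  assumes "smooth_manifold UNIV M \<A>" "c \<in> \<A>" "d \<in> \<A>" "p \<in> fst c \<inter> fst d"
  shows "(transition c d has_derivative (\<lambda>v. jacobian (transition c d) (at (snd c p)) *v v)) (at (snd c p))"
proof -
  have "transition c d differentiable at (snd c p)"
    using transition_smooth(2)[OF assms(1-3), of "Suc 0"] assms(4) by simp
  then show ?thesis using jacobian_works by blast
qed

lemma jacobian_unique:
  fixes f :: "real^'n \<Rightarrow> real^'m"
  assumes "(f has_derivative (\<lambda>v. A *v v)) (at x)"
  shows "jacobian f (at x) = A"
  unfolding jacobian_def frechet_derivative_at[OF assms, symmetric] by simp

lemma frechet_derivative_transition:
  assumes "smooth_manifold UNIV M \<A>" "c \<in> \<A>" "d \<in> \<A>" "p \<in> fst c \<inter> fst d"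
  shows "frechet_derivative (transition c d) (at (snd c p)) v = jacobian (transition c d) (at (snd c p)) *v v"
  using frechet_derivative_at[OF transition_has_derivative[OF assms]] by metis

lemma jacobian_chain:
  assumes M: "smooth_manifold UNIV M \<A>" and cde: "c \<in> \<A>" "d \<in> \<A>" "e \<in> \<A>"
    and p: "p \<in> fst c" "p \<in> fst d" "p \<in> fst e"
  shows "jacobian (transition c e) (at (snd c p)) =
    jacobian (transition d e) (at (snd d p)) ** jacobian (transition c d) (at (snd c p))"
proof (rule jacobian_unique)
  define V where "V = snd c ` (fst c \<inter> (fst d \<inter> fst e))"
  have V: "open V"
    using chart_image_openin[OF M cde(1) openin_Int[OF manifold_chart(1)[OF M cde(2)] manifold_chart(1)[OF M cde(3)]]]
    by (simp add: V_def)
  have "((\<lambda>y. transition d e (transition c d y)) has_derivative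
    (\<lambda>v. jacobian (transition d e) (at (snd d p)) *v (jacobian (transition c d) (at (snd c p)) *v v))) (at (snd c p))"
    using diff_chain_at[OF transition_has_derivative[OF M cde(1,2)], of p "transition d e"
        "\<lambda>v. jacobian (transition d e) (at (snd d p)) *v v"]
      transition_has_derivative[OF M cde(2,3), of p] p
    by (simp add: o_def transition_chart[OF M cde(1) p(1)])
  then show "(transition c e has_derivative (\<lambda>v. (jacobian (transition d e) (at (snd d p)) **
      jacobian (transition c d) (at (snd c p))) *v v)) (at (snd c p))"
    unfolding matrix_vector_mul_assoc
  proof (rule has_derivative_transform_within_open[OF _ V])
    show "snd c p \<in> V" using p by (simp add: V_def)
    fix y assume "y \<in> V"
    then obtain q where "q \<in> fst c" "q \<in> fst d" "q \<in> fst e" "y = snd c q" by (auto simp: V_def)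
    then show "transition d e (transition c d y) = transition c e y"
      by (simp add: transition_chart[OF M cde(1)] transition_chart[OF M cde(2)])
  qed
qed

lemma jacobian_self:
  assumes M: "smooth_manifold UNIV M \<A>" and "c \<in> \<A>" "p \<in> fst c"
  shows "jacobian (transition c c) (at (snd c p)) = mat 1"
proof (rule jacobian_unique)
  have "((\<lambda>y. y) has_derivative (\<lambda>v. v)) (at (snd c p))" by (rule has_derivative_ident)
  then show "(transition c c has_derivative (\<lambda>v. mat 1 *v v)) (at (snd c p))"
    unfolding matrix_vector_mul_lid
  proof (rule has_derivative_transform_within_open[OF _ chart_image_open[OF M assms(2)]])
    fix y assume "y \<in> snd c ` fst c"
    then obtain q where "q \<in> fst c" "y = snd c q" by blast
    then show "y = transition c c y" using transition_chart[OF M assms(2), of q c] by simp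
  qed (use assms in simp)
qed

lemma jacobian_inverse:
  assumes M: "smooth_manifold UNIV M \<A>" and "c \<in> \<A>" "d \<in> \<A>" "p \<in> fst c" "p \<in> fst d"
  shows "jacobian (transition d c) (at (snd d p)) ** jacobian (transition c d) (at (snd c p)) = mat 1"
  using jacobian_chain[OF M assms(2,3,2) assms(4,5,4)] jacobian_self[OF M assms(2,4)] by simp

text \<open>The constant field \<open>u\<close> in the chart \<open>c\<close>, cut off by a bump
  function, extends by zero to the whole manifold. This passes from conditions on global vector
  fields to conditions on vectors at a point.\<close>

lemma vector_field_extension:
  fixes \<A> :: "('m, 'n::finite) chart set"
  assumes M: "smooth_manifold UNIV M \<A>" and c: "c \<in> \<A>" and p: "p \<in> fst c"
  shows "\<exists>X. vector_field \<A> X \<and> X c p = u"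
proof -
  define x0 where "x0 = snd c p"
  have "x0 \<in> snd c ` fst c" using p by (simp add: x0_def)
  then obtain R where R: "R > 0" "cball x0 R \<subseteq> snd c ` fst c"
    using chart_image_open[OF M c] open_contains_cball by metis
  obtain b :: "real^'n \<Rightarrow> real" where b: "\<And>k. Ck_on k UNIV b" "b x0 = 1" "\<And>y. dist x0 y \<ge> R \<Longrightarrow> b y = 0"
    using smooth_bump[OF R(1), of x0] by blast
  define X where "X d q = (if q \<in> fst c then jacobian (transition c d) (at (snd c q)) *v (b (snd c q) *\<^sub>R u) else 0)"
    for d :: "('m, 'n) chart" and q
  \<comment> \<open>\<open>K\<close> contains the support of the field. As a compact subset of a
    Hausdorff space it is closed in \<open>M\<close>, so the field vanishes near every point outside
    the domain of \<open>c\<close>; this makes the extension by zero smooth.\<close>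
  define K where "K = inv_into (fst c) (snd c) ` cball x0 R"
  have "compactin (top_of_set (snd c ` fst c)) (cball x0 R)"
    using R(2) by (simp add: compactin_subtopology)
  then have "compactin M K"
    unfolding K_def using chart_inv_continuous[OF M c] image_compactin by blast
  then have K: "closedin M K"
    using M compactin_imp_closedin unfolding smooth_manifold_def by blast
  have X0: "X d q = 0" if "q \<notin> K" for d q
  proof (cases "q \<in> fst c")
    case True
    then have "snd c q \<notin> cball x0 R"
      using that chart_inv[OF M c True] unfolding K_def by force
    then show ?thesis using b(3) by (simp add: X_def)
  qed (simp add: X_def)
  have X_smooth: "smooth_on (snd d ` fst d) (X d \<circ> inv_into (fst d) (snd d))" if d: "d \<in> \<A>" for d
    unfolding smooth_on_open_iff[OF chart_image_open[OF M d]]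
  proof (intro allI Ck_on_local)
    fix k y assume "y \<in> snd d ` fst d"
    then obtain q where q: "q \<in> fst d" "y = snd d q" by blast
    show "\<exists>W g. open W \<and> y \<in> W \<and> Ck_on k W g \<and> (\<forall>y\<in>W. (X d \<circ> inv_into (fst d) (snd d)) y = g y)"
    proof (cases "q \<in> fst c")
      case True
      define W where "W = snd d ` (fst d \<inter> fst c)"
      \<comment> \<open>The Jacobian is replaced by the derivative in the fixed direction
        \<open>u\<close>, whose smoothness is what \<open>Ck_on\<close> provides.\<close>
      define g where "g y = b (transition d c y) *\<^sub>R frechet_derivative (transition c d) (at (transition d c y)) u" for y
      have W: "open W" unfolding W_def by (rule transition_smooth[OF M d c])
      have C1: "Ck_on k W (transition d c)" unfolding W_def by (rule transition_smooth[OF M d c])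
      have sub: "transition d c ` W \<subseteq> snd c ` (fst c \<inter> fst d)"
      proof (rule image_subsetI)
        fix z assume "z \<in> W"
        then obtain q where "q \<in> fst d" "q \<in> fst c" "z = snd d q" by (auto simp: W_def)
        then show "transition d c z \<in> snd c ` (fst c \<inter> fst d)"
          using transition_chart[OF M d, of q c] by simp
      qed
      have C2: "Ck_on k (snd c ` (fst c \<inter> fst d)) (\<lambda>z. frechet_derivative (transition c d) (at z) u)"
        using transition_smooth(2)[OF M c d, of "Suc k"] by simp
      have "Ck_on k W g"
        unfolding g_def
        by (rule Ck_on_bilinear[OF bounded_bilinear_scaleR W Ck_on_compose[OF W b(1) C1 subset_UNIV]
              Ck_on_compose[OF W C2 C1 sub]])
      moreover have "(X d \<circ> inv_into (fst d) (snd d)) z = g z" if zW: "z \<in> W" for z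
      proof -
        obtain q' where q': "q' \<in> fst d" "q' \<in> fst c" "z = snd d q'" using zW by (auto simp: W_def)
        then show ?thesis
          by (simp add: g_def X_def chart_inv[OF M d] transition_chart[OF M d]
              frechet_derivative_transition[OF M c d] matrix_vector_mult_scaleR)
      qed
      moreover have "y \<in> W" using True q by (simp add: W_def)
      ultimately show ?thesis using W by blast
    next
      case False
      have "K \<subseteq> fst c" using R(2) by (auto simp: K_def inv_into_into)
      then have qK: "q \<notin> K" using False by blast
      define W where "W = snd d ` (fst d \<inter> (topspace M - K))"
      have "openin M (topspace M - K)" using K by (simp add: closedin_def)
      then have "open W" unfolding W_def using chart_image_openin[OF M d] by simp
      moreover have "y \<in> W"
        using q qK openin_subset[OF manifold_chart(1)[OF M d]] by (auto simp: W_def)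
      moreover have "(X d \<circ> inv_into (fst d) (snd d)) z = 0" if "z \<in> W" for z
        using that X0[where d=d] chart_inv[OF M d] by (auto simp: W_def)
      ultimately show ?thesis
        by (intro exI[of _ W] exI[of _ "\<lambda>_. 0"]) simp
    qed
  qed
  have X_trans: "X e q = jacobian (transition d e) (at (snd d q)) *v X d q"
    if "d \<in> \<A>" "e \<in> \<A>" "q \<in> fst d \<inter> fst e" for d e q
  proof (cases "q \<in> fst c")
    case True
    then have "jacobian (transition c e) (at (snd c q)) =
        jacobian (transition d e) (at (snd d q)) ** jacobian (transition c d) (at (snd c q))"
      using jacobian_chain[OF M c that(1,2)] that(3) by blast
    then show ?thesis using True by (simp add: X_def matrix_vector_mul_assoc)
  qed (simp add: X_def)
  have "vector_field \<A> X"
    unfolding vector_field_def using X_smooth X_trans by blast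
  moreover have "X c p = u"
    using b(2) p jacobian_self[OF M c p] by (simp add: X_def x0_def)
  ultimately show ?thesis by (intro exI conjI)
qed

text \<open>Reduces the complex coordinate formula to the real bracket of arbitrary coordinate
  representatives, so that the remaining computations take place in \<open>real^'n\<close>. The
  representatives may be zero, as happens for the fields \<open>lmX\<close>.\<close>

lemma lie_bracket_complexify:
  fixes Z W :: "('m, 'n::finite) chart \<Rightarrow> 'm \<Rightarrow> complex^'n"
  assumes M: "smooth_manifold UNIV M \<A>" and c: "c \<in> \<A>" and p: "p \<in> fst c"
    and Z: "\<And>q. q \<in> fst c \<Longrightarrow> Z c q = complexify_vec (z (snd c q))"
    and W: "\<And>q. q \<in> fst c \<Longrightarrow> W c q = complexify_vec (w (snd c q))"
    and z': "(z has_derivative z') (at (snd c p))" and w': "(w has_derivative w') (at (snd c p))"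
  shows "lie_bracket Z W c p = complexify_vec (w' (z (snd c p)) - z' (w (snd c p)))"
proof -
  define \<psi> where "\<psi> = inv_into (fst c) (snd c)"
  have frechet: "frechet_derivative (Y c \<circ> \<psi>) (at (snd c p)) = (\<lambda>v. complexify_vec (y' v))"
    if Y: "\<And>q. q \<in> fst c \<Longrightarrow> Y c q = complexify_vec (y (snd c q))"
      and y': "(y has_derivative y') (at (snd c p))"
    for Y :: "('m, 'n) chart \<Rightarrow> 'm \<Rightarrow> complex^'n" and y y'
  proof -
    have "((\<lambda>s. complexify_vec (y s)) has_derivative (\<lambda>v. complexify_vec (y' v))) (at (snd c p))"
      by (rule bounded_linear.has_derivative[OF bounded_linear_complexify_vec y'])
    then have "(Y c \<circ> \<psi> has_derivative (\<lambda>v. complexify_vec (y' v))) (at (snd c p))"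
    proof (rule has_derivative_transform_within_open[OF _ chart_image_open[OF M c]])
      show "complexify_vec (y s) = (Y c \<circ> \<psi>) s" if "s \<in> snd c ` fst c" for s
        using that Y chart_inv[OF M c] by (auto simp: \<psi>_def)
    qed (use p in simp)
    then show ?thesis by (rule frechet_derivative_at[symmetric])
  qed
  have expand: "(\<Sum>j\<in>UNIV. complexify_vec a $ j *s complexify_vec (h (axis j 1))) = complexify_vec (h a)"
    if h: "linear h" for h :: "real^'n \<Rightarrow> real^'n" and a
  proof -
    have "h a = h (\<Sum>j\<in>UNIV. a $ j *\<^sub>R axis j 1)"
      using basis_expansion[of a] by (simp add: scalar_mult_eq_scaleR)
    also have "\<dots> = (\<Sum>j\<in>UNIV. a $ j *\<^sub>R h (axis j 1))"
      by (simp only: linear_sum[OF h] linear_cmul[OF h])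
    finally have ha: "h a = (\<Sum>j\<in>UNIV. a $ j *\<^sub>R h (axis j 1))" .
    show ?thesis
      unfolding ha by (simp add: complexify_vec_def vec_eq_iff)
  qed
  have fW: "frechet_derivative (W c \<circ> \<psi>) (at (snd c p)) = (\<lambda>v. complexify_vec (w' v))"
    by (rule frechet[of W w w']) (simp_all add: W w')
  have fZ: "frechet_derivative (Z c \<circ> \<psi>) (at (snd c p)) = (\<lambda>v. complexify_vec (z' v))"
    by (rule frechet[of Z z z']) (simp_all add: Z z')
  have "lie_bracket Z W c p = (\<Sum>j\<in>UNIV. complexify_vec (z (snd c p)) $ j *s complexify_vec (w' (axis j 1)))
      - (\<Sum>j\<in>UNIV. complexify_vec (w (snd c p)) $ j *s complexify_vec (z' (axis j 1)))"
    unfolding lie_bracket_def Let_def \<psi>_def[symmetric] fW fZ Z[OF p] W[OF p] by (rule sum_subtractf)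
  also have "\<dots> = complexify_vec (w' (z (snd c p))) - complexify_vec (z' (w (snd c p)))"
    unfolding expand[OF has_derivative_linear[OF w']] expand[OF has_derivative_linear[OF z']] ..
  also have "\<dots> = complexify_vec (w' (z (snd c p)) - z' (w (snd c p)))"
    by (simp add: complexify_vec_def vec_eq_iff)
  finally show ?thesis .
qed

section \<open>Brackets and involutivity\<close>

text \<open>Abstracts from the polynomial in \<open>F\<close>: what is kept is a smooth field of
  real projections \<open>L\<close>, compatible with changes of charts, whose complexification is
  \<open>l\<close> and whose complementary projection complexifies to \<open>m\<close>.\<close>

locale projection_field =
  fixes M :: "'m topology" and \<A> :: "('m, 'n::finite) chart set"
    and L :: "('m, 'n) chart \<Rightarrow> 'm \<Rightarrow> real^'n^'n"
    and l m :: "('m, 'n) chart \<Rightarrow> 'm \<Rightarrow> complex^'n^'n"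
  assumes M: "smooth_manifold UNIV M \<A>"
    and L_smooth: "\<And>c k. c \<in> \<A> \<Longrightarrow> Ck_on k (snd c ` fst c) (\<lambda>x. L c (inv_into (fst c) (snd c) x))"
    and L_idem: "\<And>c p. c \<in> \<A> \<Longrightarrow> p \<in> fst c \<Longrightarrow> L c p ** L c p = L c p"
    and L_trans: "\<And>c d p. c \<in> \<A> \<Longrightarrow> d \<in> \<A> \<Longrightarrow> p \<in> fst c \<Longrightarrow> p \<in> fst d \<Longrightarrow>
      L d p ** jacobian (transition c d) (at (snd c p)) = jacobian (transition c d) (at (snd c p)) ** L c p"
    and l: "\<And>c p. c \<in> \<A> \<Longrightarrow> p \<in> fst c \<Longrightarrow> l c p = map_matrix complex_of_real (L c p)"
    and m: "\<And>c p. c \<in> \<A> \<Longrightarrow> p \<in> fst c \<Longrightarrow> m c p = map_matrix complex_of_real (mat 1 - L c p)"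
begin

definition loc :: "('m, 'n) chart \<Rightarrow> real^'n \<Rightarrow> real^'n^'n" where
  "loc c x = L c (inv_into (fst c) (snd c) x)"

text \<open>Involutivity of \<open>ker L\<close>, expressed through \<open>L\<close> alone (see \<open>projection_bracket\<close>).\<close>

definition involutive :: bool where
  "involutive \<longleftrightarrow> (\<forall>c\<in>\<A>. \<forall>x\<in>snd c ` fst c. \<forall>u v. loc c x *v u = 0 \<longrightarrow> loc c x *v v = 0 \<longrightarrow>
    frechet_derivative (loc c) (at x) u *v v = frechet_derivative (loc c) (at x) v *v u)"

text \<open>The coordinate expression of the real vector field underlying \<open>mX\<close>.\<close>

definition field_m :: "(('m, 'n) chart \<Rightarrow> 'm \<Rightarrow> real^'n) \<Rightarrow> ('m, 'n) chart \<Rightarrow> real^'n \<Rightarrow> real^'n" where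
  "field_m X c x = (mat 1 - loc c x) *v X c (inv_into (fst c) (snd c) x)"

lemma loc_chart: "c \<in> \<A> \<Longrightarrow> p \<in> fst c \<Longrightarrow> loc c (snd c p) = L c p"
  by (simp add: loc_def chart_inv[OF M])

lemma Ck_loc: "c \<in> \<A> \<Longrightarrow> Ck_on k (snd c ` fst c) (loc c)"
  unfolding loc_def[abs_def] by (rule L_smooth)

lemma loc_idem: "c \<in> \<A> \<Longrightarrow> x \<in> snd c ` fst c \<Longrightarrow> loc c x ** loc c x = loc c x"
  using L_idem[of c] loc_chart[of c] by auto

lemma loc_field_m:
  assumes "c \<in> \<A>" "x \<in> snd c ` fst c"
  shows "loc c x *v field_m X c x = 0"
  unfolding field_m_def
  by (simp add: matrix_vector_mult_diff_rdistrib matrix_vector_mult_diff_distrib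
      matrix_vector_mul_assoc loc_idem[OF assms])

lemma field_m_differentiable:
  assumes "vector_field \<A> X" "c \<in> \<A>" "p \<in> fst c"
  shows "\<exists>D. (field_m X c has_derivative D) (at (snd c p))"
proof -
  note op = chart_image_open[OF M assms(2)]
  have "smooth_on (snd c ` fst c) (X c \<circ> inv_into (fst c) (snd c))"
    using assms(1,2) unfolding vector_field_def by blast
  then have X: "Ck_on (Suc 0) (snd c ` fst c) (X c \<circ> inv_into (fst c) (snd c))"
    using smooth_on_open_iff[OF op] by blast
  have "Ck_on (Suc 0) (snd c ` fst c) (\<lambda>x. mat 1 + (- 1) *\<^sub>R loc c x)"
    by (rule Ck_on_add[OF op Ck_on_const Ck_on_linear_comp[OF bounded_linear_scaleR_right op Ck_loc[OF assms(2)]]])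
  from Ck_on_bilinear[OF bounded_bilinear_matrix_vector op this X]
  have "Ck_on (Suc 0) (snd c ` fst c) (field_m X c)"
    by (simp only: field_m_def[abs_def] o_def scaleR_minus_left scaleR_one add_uminus_conv_diff)
  then show ?thesis using Ck_on_imp_has_derivative[of 0] assms(3) by blast
qed

lemma apply_m_field:
  assumes "c \<in> \<A>" "q \<in> fst c"
  shows "apply_tensor m (complexify_field X) c q = complexify_vec (field_m X c (snd c q))"
  by (simp add: apply_tensor_def complexify_field_def m[OF assms] complexify_mult_vec field_m_def
      loc_chart[OF assms] chart_inv[OF M assms])

text \<open>\<open>L\<close> annihilates \<open>mX\<close> and \<open>mY\<close> throughout the
  chart, so \<open>projection_bracket\<close> applies and no derivative of \<open>X\<close> or
  \<open>Y\<close> survives.\<close>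

lemma lie_bracket_m_fields:
  assumes X: "vector_field \<A> X" and Y: "vector_field \<A> Y" and c: "c \<in> \<A>" and p: "p \<in> fst c"
  shows "l c p *v lie_bracket (apply_tensor m (complexify_field X)) (apply_tensor m (complexify_field Y)) c p =
    complexify_vec
     (frechet_derivative (loc c) (at (snd c p)) (field_m Y c (snd c p)) *v field_m X c (snd c p)
      - frechet_derivative (loc c) (at (snd c p)) (field_m X c (snd c p)) *v field_m Y c (snd c p))"
proof -
  define x where "x = snd c p"
  have x: "x \<in> snd c ` fst c" using p by (simp add: x_def)
  obtain X' where X': "(field_m X c has_derivative X') (at x)"
    using field_m_differentiable[OF X c p] unfolding x_def by blast
  obtain Y' where Y': "(field_m Y c has_derivative Y') (at x)"
    using field_m_differentiable[OF Y c p] unfolding x_def by blast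
  have "lie_bracket (apply_tensor m (complexify_field X)) (apply_tensor m (complexify_field Y)) c p
      = complexify_vec (Y' (field_m X c x) - X' (field_m Y c x))"
    unfolding x_def
    by (rule lie_bracket_complexify[OF M c p])
      (use X' Y' in \<open>simp_all add: apply_m_field[OF c] x_def\<close>)
  moreover have "l c p = map_matrix complex_of_real (loc c x)"
    using l[OF c p] loc_chart[OF c p] by (simp add: x_def)
  moreover have "loc c x *v (Y' (field_m X c x) - X' (field_m Y c x)) =
      frechet_derivative (loc c) (at x) (field_m Y c x) *v field_m X c x
      - frechet_derivative (loc c) (at x) (field_m X c x) *v field_m Y c x"
    by (rule projection_bracket[OF chart_image_open[OF M c] x
          Ck_on_imp_has_derivative[OF Ck_loc[OF c] x] X' Y'])
      (rule loc_field_m[OF c], assumption)+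
  ultimately show ?thesis by (simp add: complexify_mult_vec x_def)
qed

text \<open>As \<open>l m = 0\<close>, the three brackets with an argument \<open>lmX\<close> or
  \<open>lmY\<close> vanish; what remains is \<open>l l [mX, mY]\<close>, and \<open>l\<close> is
  idempotent.\<close>

lemma nijenhuis_m_fields:
  assumes X: "vector_field \<A> X" and Y: "vector_field \<A> Y" and c: "c \<in> \<A>" and p: "p \<in> fst c"
  shows "nijenhuis l (apply_tensor m (complexify_field X)) (apply_tensor m (complexify_field Y)) c p =
    l c p *v lie_bracket (apply_tensor m (complexify_field X)) (apply_tensor m (complexify_field Y)) c p"
proof -
  have lm0: "apply_tensor l (apply_tensor m (complexify_field X)) c q = complexify_vec 0" if "q \<in> fst c" for X q
  proof -
    have "apply_tensor l (apply_tensor m (complexify_field X)) c q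
        = complexify_vec (L c q *v field_m X c (snd c q))"
      unfolding apply_tensor_def[of l] apply_m_field[OF c that] l[OF c that] complexify_mult_vec ..
    also have "L c q *v field_m X c (snd c q) = 0"
      using loc_field_m[OF c, of "snd c q" X] loc_chart[OF c that] that by simp
    finally show ?thesis .
  qed
  obtain X' where X': "(field_m X c has_derivative X') (at (snd c p))"
    using field_m_differentiable[OF X c p] by blast
  obtain Y' where Y': "(field_m Y c has_derivative Y') (at (snd c p))"
    using field_m_differentiable[OF Y c p] by blast
  \<comment> \<open>The zero field is presented as the complexification of a real representative, so
    that \<open>lie_bracket_complexify\<close> also evaluates brackets with a vanishing
    argument.\<close>
  have z: "((\<lambda>_. 0) has_derivative (\<lambda>_. 0)) (at (snd c p))" by simp
  have "lie_bracket (apply_tensor l (apply_tensor m (complexify_field X)))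
      (apply_tensor l (apply_tensor m (complexify_field Y))) c p = complexify_vec ((0::real^'n) - 0)"
    by (rule lie_bracket_complexify[OF M c p _ _ z z]) (simp_all only: lm0)
  moreover have "lie_bracket (apply_tensor l (apply_tensor m (complexify_field X)))
      (apply_tensor m (complexify_field Y)) c p = complexify_vec (Y' 0 - 0)"
    by (rule lie_bracket_complexify[OF M c p _ _ z Y']) (simp_all only: lm0 apply_m_field[OF c])
  moreover have "lie_bracket (apply_tensor m (complexify_field X))
      (apply_tensor l (apply_tensor m (complexify_field Y))) c p = complexify_vec (0 - X' 0)"
    by (rule lie_bracket_complexify[OF M c p _ _ X' z]) (simp_all only: lm0 apply_m_field[OF c])
  moreover have "l c p ** l c p = l c p"
    unfolding l[OF c p] complexify_matrix_mult[symmetric] L_idem[OF c p] ..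
  ultimately show ?thesis
    unfolding nijenhuis_def
    using linear_0[OF has_derivative_linear[OF X']] linear_0[OF has_derivative_linear[OF Y']]
    by (simp add: apply_tensor_def matrix_vector_mul_assoc)
qed

text \<open>By \<open>lie_bracket_m_fields\<close>, the bracket condition at a point sees only the
  values of \<open>mX\<close> and \<open>mY\<close> there. Every pair of kernel vectors arises as
  such values: extend them to global fields and note that \<open>m\<close> fixes the kernel of
  \<open>L\<close>.\<close>

lemma involutive_iff_brackets:
  "involutive \<longleftrightarrow> (\<forall>X Y. vector_field \<A> X \<and> vector_field \<A> Y \<longrightarrow>
    vanishes_on \<A> (apply_tensor l (lie_bracket
      (apply_tensor m (complexify_field X)) (apply_tensor m (complexify_field Y)))))"
proof (intro iffI allI impI)
  fix X Y assume inv: involutive and "vector_field \<A> X \<and> vector_field \<A> Y"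
  then have X: "vector_field \<A> X" and Y: "vector_field \<A> Y" by auto
  show "vanishes_on \<A> (apply_tensor l (lie_bracket
      (apply_tensor m (complexify_field X)) (apply_tensor m (complexify_field Y))))"
    unfolding vanishes_on_def
  proof (intro ballI)
    fix c p assume c: "c \<in> \<A>" and p: "p \<in> fst c"
    have x: "snd c p \<in> snd c ` fst c" using p by simp
    have "frechet_derivative (loc c) (at (snd c p)) (field_m Y c (snd c p)) *v field_m X c (snd c p)
      = frechet_derivative (loc c) (at (snd c p)) (field_m X c (snd c p)) *v field_m Y c (snd c p)"
      using inv[unfolded involutive_def, rule_format, OF c x loc_field_m[OF c x] loc_field_m[OF c x]] .
    then show "apply_tensor l (lie_bracket
      (apply_tensor m (complexify_field X)) (apply_tensor m (complexify_field Y))) c p = 0"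
      unfolding apply_tensor_def[of l] lie_bracket_m_fields[OF X Y c p] by simp
  qed
next
  assume v: "\<forall>X Y. vector_field \<A> X \<and> vector_field \<A> Y \<longrightarrow>
    vanishes_on \<A> (apply_tensor l (lie_bracket
      (apply_tensor m (complexify_field X)) (apply_tensor m (complexify_field Y))))"
  show involutive
    unfolding involutive_def
  proof (intro ballI allI impI)
    fix c x u v assume c: "c \<in> \<A>" and "x \<in> snd c ` fst c" and u: "loc c x *v u = 0" and v': "loc c x *v v = 0"
    then obtain p where p: "p \<in> fst c" "x = snd c p" by blast
    obtain X where X: "vector_field \<A> X" "X c p = v"
      using vector_field_extension[OF M c p(1)] by blast
    obtain Y where Y: "vector_field \<A> Y" "Y c p = u"
      using vector_field_extension[OF M c p(1)] by blast
    have fX: "field_m X c x = v"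
      using X(2) v' by (simp add: field_m_def p(2) chart_inv[OF M c p(1)] matrix_vector_mult_diff_rdistrib)
    have fY: "field_m Y c x = u"
      using Y(2) u by (simp add: field_m_def p(2) chart_inv[OF M c p(1)] matrix_vector_mult_diff_rdistrib)
    have "apply_tensor l (lie_bracket
      (apply_tensor m (complexify_field X)) (apply_tensor m (complexify_field Y))) c p = 0"
      using v X(1) Y(1) c p(1) unfolding vanishes_on_def by blast
    then have "l c p *v lie_bracket
      (apply_tensor m (complexify_field X)) (apply_tensor m (complexify_field Y)) c p = 0"
      by (simp only: apply_tensor_def[of l])
    then show "frechet_derivative (loc c) (at x) u *v v = frechet_derivative (loc c) (at x) v *v u"
      unfolding lie_bracket_m_fields[OF X(1) Y(1) c p(1)] p(2)[symmetric] fX fY by simp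
  qed
qed

lemma distribution_m:
  assumes "c \<in> \<A>" "p \<in> fst c"
  shows "distribution_of m c p = complexify_subspace {v. L c p *v v = 0}"
  unfolding distribution_of_def m[OF assms] complexify_kernel[OF L_idem[OF assms]] ..

end

section \<open>Integral manifolds\<close>

text \<open>For \<open>w\<close> in \<open>E\<close> the line \<open>s + t w\<close> stays in
  \<open>S\<close> for small \<open>t\<close>, and pulling back along it reduces the claim to
  uniqueness of derivatives in one variable. It identifies the derivative in the definition of an
  integral manifold with that of a local smooth extension, on \<open>E\<close>.\<close>

lemma derivative_unique_on_subspace:
  fixes h :: "'a::euclidean_space \<Rightarrow> 'b::real_normed_vector"
  assumes E: "subspace E" "openin (top_of_set E) S" "s \<in> S" "w \<in> E"
    and f: "(h has_derivative f) (at s within S)" and g: "(h has_derivative g) (at s within S)"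
  shows "f w = g w"
proof -
  obtain T where T: "open T" "S = E \<inter> T" using E(2) openin_open by metis
  define line where "line t = s + t *\<^sub>R w" for t :: real
  define U where "U = line -` T"
  have "continuous_on UNIV line" unfolding line_def by (intro continuous_intros)
  then have U: "open U" unfolding U_def using T(1) by (intro open_vimage) auto
  have U0: "0 \<in> U" using E(3) T by (simp add: U_def line_def)
  have US: "line ` U \<subseteq> S"
    using E T by (auto simp: U_def line_def subspace_add subspace_scale)
  have line': "(line has_derivative (\<lambda>t. t *\<^sub>R w)) (at 0 within U)"
    unfolding line_def by (auto intro!: derivative_eq_intros)
  have *: "((\<lambda>t. h (line t)) has_derivative (\<lambda>t. k (t *\<^sub>R w))) (at 0)"
    if "(h has_derivative k) (at s within S)" for k
  proof -
    have "(h has_derivative k) (at (line 0) within line ` U)"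
      using has_derivative_subset[OF that US] by (simp add: line_def)
    from diff_chain_within[OF line' this]
    have "((\<lambda>t. h (line t)) has_derivative (\<lambda>t. k (t *\<^sub>R w))) (at 0 within U)" by (simp add: o_def)
    then show ?thesis using at_within_open[OF U0 U] by simp
  qed
  have "(\<lambda>t. f (t *\<^sub>R w)) = (\<lambda>t. g (t *\<^sub>R w))"
    using has_derivative_unique[OF *[OF f] *[OF g]] .
  from fun_cong[OF this, of 1] show ?thesis by simp
qed

context projection_field
begin

text \<open>The inclusion of the integral manifold, read in charts, is extended locally to a smooth
  map \<open>g\<close> on an open set. On \<open>E\<close> its derivative takes values in the kernel
  of \<open>L\<close>, and at the given point it reaches every kernel vector, so
  \<open>integral_map_symmetric\<close> covers all pairs \<open>u\<close>, \<open>v\<close>.\<close>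

lemma integrable_imp_involutive:
  assumes "integrable_distribution M \<A> (distribution_of m)"
  shows involutive
  unfolding involutive_def
proof (intro ballI allI impI)
  fix c x u v assume c: "c \<in> \<A>" and "x \<in> snd c ` fst c" and u: "loc c x *v u = 0" and v: "loc c x *v v = 0"
  then obtain p where p: "p \<in> fst c" "x = snd c p" by blast
  have "p \<in> topspace M" using openin_subset[OF manifold_chart(1)[OF M c]] p by blast
  then obtain E N \<B> where N: "integral_manifold M \<A> (distribution_of m) E N \<B>" "p \<in> topspace N"
    using assms unfolding integrable_distribution_def by blast
  have smN: "smooth_manifold E N \<B>" and contN: "continuous_map N M id"
    using N(1) unfolding integral_manifold_def by auto
  have E: "subspace E" and covN: "(\<Union>d\<in>\<B>. fst d) = topspace N"
    using smN unfolding smooth_manifold_def by auto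
  obtain d where d: "d \<in> \<B>" "p \<in> fst d" using N(2) covN by blast
  define S where "S = snd d ` (fst d \<inter> fst c)"
  \<comment> \<open>The integral manifold carries its own topology; continuity of the inclusion is
    what makes the domain of \<open>c\<close> open in it.\<close>
  have "openin N {q \<in> topspace N. id q \<in> fst c}"
    using contN manifold_chart(1)[OF M c] unfolding continuous_map_def by blast
  from chart_image_openin[OF smN d(1) this]
  have "openin (top_of_set E) (snd d ` (fst d \<inter> {q \<in> topspace N. id q \<in> fst c}))" .
  moreover have "fst d \<inter> {q \<in> topspace N. id q \<in> fst c} = fst d \<inter> fst c"
    using openin_subset[OF manifold_chart(1)[OF smN d(1)]] by auto
  ultimately have S: "openin (top_of_set E) S" by (simp add: S_def)
  have smS: "smooth_on S (transition d c)"
    and tan: "\<And>q. q \<in> fst d \<Longrightarrow> q \<in> fst c \<Longrightarrow> \<exists>f'. (transition d c has_derivative f') (at (snd d q) within S) \<and>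
           inj_on f' E \<and> complexify_subspace (f' ` E) = distribution_of m c q"
    using N(1) d(1) c unfolding integral_manifold_def S_def by blast+
  define s0 where "s0 = snd d p"
  have s0: "s0 \<in> S" using d(2) p(1) by (simp add: s0_def S_def)
  obtain W g where W: "open W" "s0 \<in> W" and g: "\<And>k. Ck_on k W g"
    and geq: "\<And>y. y \<in> S \<inter> W \<Longrightarrow> transition d c y = g y"
    using smS s0 unfolding smooth_on_def by metis
  have gW: "(g has_derivative frechet_derivative g (at s)) (at s)" if "s \<in> W" for s
    using Ck_on_imp_has_derivative[OF g that] .
  have tangent: "\<exists>f'. (\<forall>w\<in>E. f' w = frechet_derivative g (at (snd d q)) w) \<and> linear f' \<and>
      complexify_subspace (f' ` E) = distribution_of m c q"
    if q: "q \<in> fst d" "q \<in> fst c" "snd d q \<in> W" for q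
  proof -
    obtain f' where f': "(transition d c has_derivative f') (at (snd d q) within S)"
      "complexify_subspace (f' ` E) = distribution_of m c q"
      using tan[OF q(1,2)] by blast
    have qS: "snd d q \<in> S" using q by (simp add: S_def)
    obtain r where r: "r > 0" "ball (snd d q) r \<subseteq> W" using W(1) q(3) open_contains_ball by metis
    have "(transition d c has_derivative frechet_derivative g (at (snd d q))) (at (snd d q) within S)"
    proof (rule has_derivative_transform_within[OF has_derivative_at_withinI[OF gW[OF q(3)]] r(1) qS])
      show "g y = transition d c y" if "y \<in> S" "dist y (snd d q) < r" for y
        using geq[of y] that r(2) by (auto simp: dist_commute)
    qed
    then have "f' w = frechet_derivative g (at (snd d q)) w" if "w \<in> E" for w
      using derivative_unique_on_subspace[OF E S qS that f'(1)] by blast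
    then show ?thesis using f' has_derivative_linear by blast
  qed
  have gs: "g (snd d q) = snd c q" if "q \<in> fst d" "q \<in> fst c" "snd d q \<in> W" for q
    using geq[of "snd d q"] transition_chart[OF smN d(1) that(1), of c] that by (simp add: S_def)
  have gx: "g s0 = x" using gs[OF d(2) p(1)] W(2) by (simp add: s0_def p(2))
  have L0: "loc c (g s) *v frechet_derivative g (at s) w = 0" if sw: "s \<in> S \<inter> W" "w \<in> E" for s w
  proof -
    obtain q where q: "q \<in> fst d" "q \<in> fst c" "s = snd d q" using sw(1) by (auto simp: S_def)
    then obtain f' where f': "\<forall>w\<in>E. f' w = frechet_derivative g (at s) w" "linear f'"
      "complexify_subspace (f' ` E) = distribution_of m c q"
      using tangent[of q] sw(1) by blast
    \<comment> \<open>The imaginary part is chosen as \<open>f' 0 = 0\<close>, so the complexified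
      image contains \<open>f' w\<close> itself.\<close>
    have "complexify_vec (f' w) + \<i> *s complexify_vec (f' 0) \<in> complexify_subspace (f' ` E)"
      unfolding complexify_subspace_def using sw(2) subspace_0[OF E] by blast
    then have "complexify_vec (f' w) \<in> complexify_subspace {v. L c q *v v = 0}"
      unfolding f'(3) distribution_m[OF c q(2)] by (simp add: linear_0[OF f'(2)])
    then obtain a b where ab: "complexify_vec (f' w) = complexify_vec a + \<i> *s complexify_vec b" "L c q *v a = 0"
      unfolding complexify_subspace_def by blast
    have "f' w = a" by (rule complexify_split_eq_complexify[OF ab(1)])
    then have "L c q *v f' w = 0" using ab(2) by simp
    moreover have "g s = snd c q" using gs[OF q(1,2)] sw(1) by (simp add: q(3))
    ultimately show ?thesis using f'(1) sw(2) loc_chart[OF c q(2)] by simp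
  qed
  have onto: "\<exists>a\<in>E. z = frechet_derivative g (at s0) a" if z: "loc c x *v z = 0" for z
  proof -
    obtain f' where f': "\<forall>w\<in>E. f' w = frechet_derivative g (at s0) w"
      "complexify_subspace (f' ` E) = distribution_of m c p"
      using tangent[OF d(2) p(1)] W(2) unfolding s0_def by blast
    have "L c p *v z = 0" using z loc_chart[OF c p(1)] by (simp add: p(2))
    then have "complexify_vec z + \<i> *s complexify_vec 0 \<in> complexify_subspace {v. L c p *v v = 0}"
      unfolding complexify_subspace_def by (intro CollectI exI[of _ z] exI[of _ 0]) simp
    then have "complexify_vec z \<in> complexify_subspace (f' ` E)"
      unfolding f'(2) distribution_m[OF c p(1)] by simp
    then obtain a b where ab: "complexify_vec z = complexify_vec a + \<i> *s complexify_vec b" "a \<in> f' ` E"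
      unfolding complexify_subspace_def by blast
    have "z = a" by (rule complexify_split_eq_complexify[OF ab(1)])
    then show ?thesis using ab(2) f'(1) by auto
  qed
  obtain a where a: "a \<in> E" "u = frechet_derivative g (at s0) a" using onto[OF u] by blast
  obtain b where b: "b \<in> E" "v = frechet_derivative g (at s0) b" using onto[OF v] by blast
  have l': "(loc c has_derivative frechet_derivative (loc c) (at x)) (at (g s0))"
    unfolding gx by (rule Ck_on_imp_has_derivative[OF Ck_loc[OF c]]) (simp add: p)
  show "frechet_derivative (loc c) (at x) u *v v = frechet_derivative (loc c) (at x) v *v u"
    unfolding a(2) b(2)
    by (rule integral_map_symmetric[OF W g l' E S s0 L0 b(1) a(1)])
qed

text \<open>A single chart suffices: the integral manifold is the image \<open>Q\<close> of
  \<open>S\<close> under the local solution, with the topology induced from \<open>M\<close>, from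
  which it inherits the Hausdorff property and second countability.\<close>

lemma involutive_imp_integrable:
  assumes involutive
  shows "integrable_distribution M \<A> (distribution_of m)"
  unfolding integrable_distribution_def
proof (intro ballI)
  fix p assume "p \<in> topspace M"
  then obtain c where c: "c \<in> \<A>" "p \<in> fst c"
    using M unfolding smooth_manifold_def by blast
  define U where "U = snd c ` fst c"
  define \<psi> where "\<psi> = inv_into (fst c) (snd c)"
  define x0 where "x0 = snd c p"
  define m0 where "m0 = mat 1 - loc c x0"
  have U: "open U" unfolding U_def by (rule chart_image_open[OF M c(1)])
  have x0: "x0 \<in> U" using c by (simp add: U_def x0_def)
  have \<psi>: "\<psi> x \<in> fst c" "snd c (\<psi> x) = x" if "x \<in> U" for x
    using that unfolding U_def \<psi>_def by (auto simp: inv_into_into f_inv_into_f)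
  obtain \<delta> f D where \<delta>: "\<delta> > 0" "f 0 = x0" and Cf: "\<And>k. Ck_on k (ball 0 \<delta>) f"
    and fD: "\<And>w. w \<in> ball 0 \<delta> \<Longrightarrow> f w \<in> U" "\<And>w. w \<in> ball 0 \<delta> \<Longrightarrow> m0 *v (f w - x0) = m0 *v w"
      "\<And>w. w \<in> ball 0 \<delta> \<Longrightarrow> (f has_derivative D w) (at w)"
      "\<And>w v. w \<in> ball 0 \<delta> \<Longrightarrow> m0 *v D w v = m0 *v v"
      "\<And>w v. w \<in> ball 0 \<delta> \<Longrightarrow> loc c (f w) *v D w v = 0"
      "\<And>w u. w \<in> ball 0 \<delta> \<Longrightarrow> loc c (f w) *v u = 0 \<Longrightarrow> D w (m0 *v u) = u"
  proof -
    have "\<exists>\<delta>>0. \<exists>f D. f 0 = x0 \<and> (\<forall>k. Ck_on k (ball 0 \<delta>) f) \<and>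
      (\<forall>w\<in>ball 0 \<delta>. f w \<in> U \<and> m0 *v (f w - x0) = m0 *v w \<and> (f has_derivative D w) (at w) \<and>
        (\<forall>v. m0 *v D w v = m0 *v v \<and> loc c (f w) *v D w v = 0) \<and>
        (\<forall>u. loc c (f w) *v u = 0 \<longrightarrow> D w (m0 *v u) = u))"
      unfolding m0_def
    proof (rule frobenius_local[OF U x0])
      show "Ck_on k U (loc c)" for k unfolding U_def by (rule Ck_loc[OF c(1)])
      show "loc c x ** loc c x = loc c x" if "x \<in> U" for x using loc_idem[OF c(1)] that by (simp add: U_def)
      show "frechet_derivative (loc c) (at x) u *v v = frechet_derivative (loc c) (at x) v *v u"
        if "x \<in> U" "loc c x *v u = 0" "loc c x *v v = 0" for x u v
        using assms that c(1) unfolding involutive_def U_def by blast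
    qed
    then show ?thesis using that by blast
  qed
  define E where "E = range ((*v) m0)"
  define S where "S = E \<inter> ball 0 \<delta>"
  define Q where "Q = (\<lambda>s. \<psi> (f s)) ` S"
  \<comment> \<open>The solution is a graph over \<open>im m0\<close>, so this linear projection of
    the ambient coordinates recovers its parameter and is a chart defined without inverting
    \<open>f\<close>.\<close>
  define \<phi> where "\<phi> q = m0 *v (snd c q - x0)" for q
  define N where "N = subtopology M Q"
  define \<B> where "\<B> = {(Q, \<phi>)}"
  have E: "subspace E" unfolding E_def by (rule linear_subspace_image[OF matrix_vector_mul_linear subspace_UNIV])
  have m0m0: "m0 ** m0 = m0"
    using loc_idem[OF c(1), of x0] x0 unfolding m0_def U_def
    by (simp add: matrix_diff_left matrix_diff_right)
  have m0E: "m0 *v e = e" if "e \<in> E" for e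
    using that by (auto simp: E_def matrix_vector_mul_assoc m0m0)
  have S: "openin (top_of_set E) S" "S \<subseteq> ball 0 \<delta>" "S \<subseteq> E" by (auto simp: S_def openin_open)
  have \<psi>f: "\<psi> (f s) \<in> fst c" "snd c (\<psi> (f s)) = f s" if "s \<in> S" for s
    using \<psi> fD(1) that S(2) by blast+
  have \<phi>: "\<phi> (\<psi> (f s)) = s" if "s \<in> S" for s
  proof -
    have "s \<in> ball 0 \<delta>" "s \<in> E" using that S by blast+
    then show ?thesis unfolding \<phi>_def \<psi>f(2)[OF that] using fD(2) m0E by metis
  qed
  have QM: "Q \<subseteq> fst c" "Q \<subseteq> topspace M"
  proof -
    show "Q \<subseteq> fst c" using \<psi>f by (auto simp: Q_def)
    then show "Q \<subseteq> topspace M" using openin_subset[OF manifold_chart(1)[OF M c(1)]] by blast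
  qed
  have topN: "topspace N = Q" using QM(2) by (auto simp: N_def)
  have \<phi>Q: "\<phi> ` Q = S" using \<phi> by (force simp: Q_def)
  have \<phi>inv: "inv_into Q \<phi> s = \<psi> (f s)" if "s \<in> S" for s
  proof (rule inv_into_f_eq)
    show "inj_on \<phi> Q" by (rule inj_onI) (auto simp: Q_def \<phi>)
    show "\<psi> (f s) \<in> Q" using that by (simp add: Q_def)
  qed (rule \<phi>[OF that])
  have f_cont: "continuous_on (ball 0 \<delta>) f" using Ck_on_imp_continuous[OF Cf] .
  have hom: "homeomorphic_map N (top_of_set S) \<phi>"
  proof -
    have "homeomorphic_maps N (top_of_set S) \<phi> (\<lambda>s. \<psi> (f s))"
      unfolding homeomorphic_maps_def
    proof (intro conjI ballI)
      have "continuous_map (subtopology M (fst c)) euclidean (snd c)"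
        using homeomorphic_imp_continuous_map[OF manifold_chart(3)[OF M c(1)]]
          continuous_map_into_fulltopology by blast
      then have "continuous_map N euclidean (snd c)"
        unfolding N_def using continuous_map_from_subtopology_mono QM(1) by blast
      moreover have "continuous_map euclidean euclidean (\<lambda>y. m0 *v (y - x0))"
        unfolding continuous_map_iff_continuous2
        by (rule bounded_linear.continuous_on[OF matrix_vector_mul_bounded_linear
              continuous_on_diff[OF continuous_on_id continuous_on_const]])
      ultimately have "continuous_map N euclidean ((\<lambda>y. m0 *v (y - x0)) \<circ> snd c)"
        by (rule continuous_map_compose)
      then have "continuous_map N euclidean \<phi>" by (simp add: \<phi>_def[abs_def] o_def)
      then show "continuous_map N (top_of_set S) \<phi>"
        by (rule continuous_map_into_subtopology) (use \<phi>Q topN in auto)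
      have "continuous_map (top_of_set S) euclidean f"
        using continuous_on_subset[OF f_cont S(2)] by simp
      then have "continuous_map (top_of_set S) (top_of_set U) f"
        by (rule continuous_map_into_subtopology) (use fD(1) S(2) in auto)
      then have "continuous_map (top_of_set S) M (\<psi> \<circ> f)"
        using continuous_map_compose chart_inv_continuous[OF M c(1)] unfolding U_def \<psi>_def by blast
      then show "continuous_map (top_of_set S) N (\<lambda>s. \<psi> (f s))"
        unfolding N_def o_def by (rule continuous_map_into_subtopology) (auto simp: Q_def)
      show "\<psi> (f (\<phi> q)) = q" if "q \<in> topspace N" for q
        using that \<phi> unfolding topN Q_def by auto
      show "\<phi> (\<psi> (f s)) = s" if "s \<in> topspace (top_of_set S)" for s using that \<phi> by simp
    qed
    then show ?thesis using homeomorphic_map_maps by blast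
  qed
  have "smooth_manifold E N \<B>"
  proof -
    have "Hausdorff_space N" "second_countable N"
      unfolding N_def using M Hausdorff_space_subtopology second_countable_subtopology
      unfolding smooth_manifold_def by blast+
    moreover have "openin N Q" using openin_topspace[of N] unfolding topN .
    moreover have "homeomorphic_map (subtopology N Q) (top_of_set (\<phi> ` Q)) \<phi>"
      using hom unfolding \<phi>Q by (metis topN subtopology_topspace)
    moreover have "smooth_on (\<phi> ` (Q \<inter> Q)) (transition (Q, \<phi>) (Q, \<phi>))"
      unfolding smooth_on_def
    proof (intro ballI exI conjI allI)
      show "Ck_on k UNIV (\<lambda>y. y)" for k by (rule Ck_on_linear[OF bounded_linear_ident open_UNIV])
      show "transition (Q, \<phi>) (Q, \<phi>) y = y" if "y \<in> \<phi> ` (Q \<inter> Q) \<inter> UNIV" for y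
        using that \<phi>Q \<phi>inv \<phi> by (simp add: transition_def)
    qed auto
    ultimately show ?thesis
      unfolding smooth_manifold_def \<B>_def using E S(1) topN \<phi>Q by simp
  qed
  moreover have "topspace N \<subseteq> topspace M" unfolding topN by (rule QM(2))
  moreover have "continuous_map N M id"
    unfolding N_def by (rule continuous_map_from_subtopology[OF continuous_map_id])
  moreover have "smooth_on (\<phi> ` (Q \<inter> fst e)) (transition (Q, \<phi>) e) \<and>
      (\<forall>q\<in>Q \<inter> fst e. \<exists>f'. (transition (Q, \<phi>) e has_derivative f') (at (\<phi> q) within \<phi> ` (Q \<inter> fst e)) \<and>
           inj_on f' E \<and> complexify_subspace (f' ` E) = distribution_of m e q)" if e: "e \<in> \<A>" for e
  proof -
    define T where "T = \<phi> ` (Q \<inter> fst e)"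
    define W where "W = {w \<in> ball 0 \<delta>. f w \<in> snd c ` (fst c \<inter> fst e)}"
    \<comment> \<open>Because \<open>f\<close> is defined on the full ball, \<open>g\<close> extends
      the transition from the relatively open set \<open>T\<close> to the open set \<open>W\<close>,
      as smoothness on a subset demands.\<close>
    define g where "g w = transition c e (f w)" for w
    note tr = transition_smooth[OF M c(1) e]
    have "open (ball 0 \<delta> \<inter> f -` (snd c ` (fst c \<inter> fst e)))"
      by (rule continuous_open_preimage[OF f_cont open_ball tr(1)])
    then have W: "open W" by (simp add: W_def vimage_def Int_def)
    have g: "Ck_on k W g" for k
      unfolding g_def
      by (rule Ck_on_compose[OF W tr(2) Ck_on_subset[OF Cf]]) (auto simp: W_def)
    have T: "s \<in> S \<and> s \<in> W \<and> \<psi> (f s) \<in> fst e \<and> s = \<phi> (\<psi> (f s))" if "s \<in> T" for s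
    proof -
      obtain r where r: "r \<in> S" "\<psi> (f r) \<in> fst e" "s = \<phi> (\<psi> (f r))" using \<open>s \<in> T\<close> by (auto simp: T_def Q_def)
      then have "s = r" using \<phi> by simp
      moreover have "f r \<in> snd c ` (fst c \<inter> fst e)"
        using \<psi>f[OF r(1)] r(2) by (metis IntI image_eqI)
      ultimately show ?thesis using r S(2) by (auto simp: W_def)
    qed
    have tg: "transition (Q, \<phi>) e s = g s" if "s \<in> T" for s
    proof -
      have s: "s \<in> S" using T[OF that] by blast
      have "transition (Q, \<phi>) e s = snd e (\<psi> (f s))" by (simp add: transition_def \<phi>inv[OF s])
      also have "\<dots> = transition c e (snd c (\<psi> (f s)))"
        by (rule transition_chart[OF M c(1) \<psi>f(1)[OF s], symmetric])
      finally show ?thesis unfolding g_def \<psi>f(2)[OF s] .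
    qed
    have "smooth_on T (transition (Q, \<phi>) e)"
      unfolding smooth_on_def using T W g tg by blast
    moreover have "\<exists>f'. (transition (Q, \<phi>) e has_derivative f') (at (\<phi> q) within T) \<and>
           inj_on f' E \<and> complexify_subspace (f' ` E) = distribution_of m e q"
      if q: "q \<in> Q" "q \<in> fst e" for q
    proof -
      obtain s where s: "s \<in> S" "q = \<psi> (f s)" using q by (auto simp: Q_def)
      have \<phi>q: "\<phi> q = s" using \<phi> s by simp
      have sT: "s \<in> T" using q \<phi>q unfolding T_def by (metis IntI image_eqI)
      have sB: "s \<in> ball 0 \<delta>" using s S(2) by blast
      have qc: "q \<in> fst c" "snd c q = f s" using s \<psi>f by auto
      have locq: "loc c (f s) = L c q" using loc_chart[OF c(1) qc(1)] qc(2) by simp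
      define J where "J = jacobian (transition c e) (at (f s))"
      define J' where "J' = jacobian (transition e c) (at (snd e q))"
      have JJ: "J' ** J = mat 1" "J ** J' = mat 1"
        using jacobian_inverse[OF M c(1) e qc(1) q(2)] jacobian_inverse[OF M e c(1) q(2) qc(1)]
        by (simp_all add: J_def J'_def qc(2))
      \<comment> \<open>The tangent space is computed in the chart \<open>c\<close>; these relations
        carry the kernel of \<open>L\<close> over to an arbitrary chart \<open>e\<close> and
        back.\<close>
      have LJ: "L e q ** J = J ** L c q" "L c q ** J' = J' ** L e q"
        using L_trans[OF c(1) e qc(1) q(2)] L_trans[OF e c(1) q(2) qc(1)] by (simp_all add: J_def J'_def qc(2))
      define f' where "f' v = J *v D s v" for v
      have "(transition c e has_derivative (\<lambda>v. J *v v)) (at (f s))"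
        using transition_has_derivative[OF M c(1) e, of q] qc q(2) by (simp add: J_def)
      from diff_chain_at[OF fD(3)[OF sB] this]
      have gd: "(g has_derivative f') (at s)" by (simp add: g_def[abs_def] f'_def[abs_def] o_def)
      have "(transition (Q, \<phi>) e has_derivative f') (at s within T)"
        by (rule has_derivative_transform[OF sT _ has_derivative_at_withinI[OF gd]]) (rule tg)
      moreover have "inj_on f' E"
      proof (rule inj_onI)
        fix a b assume ab: "a \<in> E" "b \<in> E" "f' a = f' b"
        then have "J' *v (J *v D s a) = J' *v (J *v D s b)" by (simp add: f'_def)
        then have "D s a = D s b" unfolding matrix_vector_mul_assoc JJ matrix_vector_mul_lid .
        then have "m0 *v a = m0 *v b" using fD(4)[OF sB] by metis
        then show "a = b" using m0E ab by simp
      qed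
      moreover have "f' ` E = {v. L e q *v v = 0}"
      proof (intro set_eqI iffI)
        fix y assume "y \<in> f' ` E"
        then obtain a where "y = J *v D s a" by (auto simp: f'_def)
        then have "L e q *v y = J *v (L c q *v D s a)" by (simp add: matrix_vector_mul_assoc LJ)
        then show "y \<in> {v. L e q *v v = 0}" using fD(5)[OF sB, of a] by (simp add: locq)
      next
        fix y assume "y \<in> {v. L e q *v v = 0}"
        then have "L c q *v (J' *v y) = J' *v 0" by (simp add: matrix_vector_mul_assoc LJ flip: matrix_vector_mul_assoc[of J'])
        then have "D s (m0 *v (J' *v y)) = J' *v y" using fD(6)[OF sB, of "J' *v y"] locq by simp
        then have "f' (m0 *v (J' *v y)) = y" by (simp add: f'_def matrix_vector_mul_assoc JJ)
        moreover have "m0 *v (J' *v y) \<in> E" by (simp add: E_def)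
        ultimately show "y \<in> f' ` E" by (metis image_eqI)
      qed
      ultimately show ?thesis unfolding \<phi>q distribution_m[OF e q(2)] by metis
    qed
    ultimately show ?thesis unfolding T_def by blast
  qed
  ultimately have "integral_manifold M \<A> (distribution_of m) E N \<B>"
    unfolding integral_manifold_def by (simp add: \<B>_def)
  moreover have "p \<in> topspace N"
  proof -
    have "0 \<in> S" using \<delta>(1) subspace_0[OF E] by (simp add: S_def)
    moreover have "\<psi> (f 0) = p" unfolding \<delta>(2) x0_def \<psi>_def by (rule chart_inv[OF M c])
    ultimately show ?thesis unfolding topN Q_def by (metis image_eqI)
  qed
  ultimately show "\<exists>E N \<B>. integral_manifold M \<A> (distribution_of m) E N \<B> \<and> p \<in> topspace N" by blast
qed

end

section \<open>Specialization to \<open>F\<close>-structures\<close>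

lemma F_structure_projection_field:
  fixes F :: "('m, 'n::finite) chart \<Rightarrow> 'm \<Rightarrow> real^'n^'n"
  assumes "F_structure_manifold M \<A> F r K \<alpha> \<beta>"
  shows "projection_field M \<A>
    (\<lambda>c p. - (Re \<alpha> *\<^sub>R mat_power (F c p) K + Re \<beta> *\<^sub>R mat_power (F c p) (K - 1)))
    (proj_l F K \<alpha> \<beta>) (proj_m F K \<alpha> \<beta>)"
proof -
  define L where "L c p = - (Re \<alpha> *\<^sub>R mat_power (F c p) K + Re \<beta> *\<^sub>R mat_power (F c p) (K - 1))" for c p
  have M: "smooth_manifold UNIV M \<A>" and F: "tensor_field_1_1 \<A> F" and K: "2 \<le> K"
    using assms unfolding F_structure_manifold_def by auto
  have eq: "mat \<alpha> ** mat_power (map_matrix complex_of_real (F c p)) (K + 1)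
      + mat \<beta> ** mat_power (map_matrix complex_of_real (F c p)) K
      + mat_power (map_matrix complex_of_real (F c p)) 1 = 0" if "c \<in> \<A>" "p \<in> fst c" for c p
    using assms that unfolding F_structure_manifold_def tensor_power_def by blast
  have l: "proj_l F K \<alpha> \<beta> c p = map_matrix complex_of_real (L c p)" if "c \<in> \<A>" "p \<in> fst c" for c p
    unfolding proj_l_def tensor_power_def L_def by (rule structure_projection(2)[OF K eq[OF that]])
  have m: "proj_m F K \<alpha> \<beta> c p = map_matrix complex_of_real (mat 1 - L c p)" if "c \<in> \<A>" "p \<in> fst c" for c p
  proof -
    have "proj_m F K \<alpha> \<beta> c p = mat 1 - proj_l F K \<alpha> \<beta> c p"
      by (simp add: proj_m_def proj_l_def add.assoc)
    also have "\<dots> = map_matrix complex_of_real (mat 1 - L c p)"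
      unfolding l[OF that] by (simp add: vec_eq_iff mat_def)
    finally show ?thesis .
  qed
  have trans: "L d p ** jacobian (transition c d) (at (snd c p)) = jacobian (transition c d) (at (snd c p)) ** L c p"
    if "c \<in> \<A>" "d \<in> \<A>" "p \<in> fst c" "p \<in> fst d" for c d p
  proof -
    have "F d p ** jacobian (transition c d) (at (snd c p)) = jacobian (transition c d) (at (snd c p)) ** F c p"
      using F that unfolding tensor_field_1_1_def by blast
    from mat_power_intertwine[OF this] show ?thesis
      by (simp only: L_def matrix_add_left matrix_add_right matrix_scaleR_left matrix_scaleR_right
          matrix_minus_left matrix_minus_right)
  qed
  have smooth: "Ck_on k (snd c ` fst c) (\<lambda>x. L c (inv_into (fst c) (snd c) x))" if c: "c \<in> \<A>" for c k
  proof -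
    note op = chart_image_open[OF M c]
    have "smooth_on (snd c ` fst c) (F c \<circ> inv_into (fst c) (snd c))"
      using F c unfolding tensor_field_1_1_def by blast
    then have "Ck_on k (snd c ` fst c) (\<lambda>x. F c (inv_into (fst c) (snd c) x))"
      unfolding smooth_on_open_iff[OF op] o_def by blast
    note pow = Ck_on_mat_power[OF op this]
    show ?thesis
      unfolding L_def
      by (rule Ck_on_linear_comp[OF bounded_linear_minus[OF bounded_linear_ident] op
            Ck_on_add[OF op Ck_on_linear_comp[OF bounded_linear_scaleR_right op pow]
              Ck_on_linear_comp[OF bounded_linear_scaleR_right op pow]]])
  qed
  have "L c p ** L c p = L c p" if "c \<in> \<A>" "p \<in> fst c" for c p
    unfolding L_def by (rule structure_projection(1)[OF K eq[OF that]])
  then have "projection_field M \<A> L (proj_l F K \<alpha> \<beta>) (proj_m F K \<alpha> \<beta>)"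
    using M smooth trans l m by unfold_locales
  then show ?thesis by (simp only: L_def[abs_def])
qed

theorem theorem5p2:
  fixes M :: "'m topology"
    and \<A> :: "('m, 'n::finite) chart set"
    and F :: "('m, 'n) chart \<Rightarrow> 'm \<Rightarrow> real^'n^'n"
    and r K :: nat
    and \<alpha> \<beta> :: complex
  assumes "F_structure_manifold M \<A> F r K \<alpha> \<beta>"
  defines "l \<equiv> proj_l F K \<alpha> \<beta>"
    and "m \<equiv> proj_m F K \<alpha> \<beta>"
  shows "(integrable_distribution M \<A> (distribution_of m) \<longleftrightarrow>
           (\<forall>X Y. vector_field \<A> X \<and> vector_field \<A> Y \<longrightarrow>
              vanishes_on \<A> (nijenhuis l (apply_tensor m (complexify_field X))
                                         (apply_tensor m (complexify_field Y))))) \<and>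
         (integrable_distribution M \<A> (distribution_of m) \<longleftrightarrow>
           (\<forall>X Y. vector_field \<A> X \<and> vector_field \<A> Y \<longrightarrow>
              vanishes_on \<A> (apply_tensor l (lie_bracket
                                         (apply_tensor m (complexify_field X))
                                         (apply_tensor m (complexify_field Y))))))"
proof -
  interpret projection_field M \<A>
    "\<lambda>c p. - (Re \<alpha> *\<^sub>R mat_power (F c p) K + Re \<beta> *\<^sub>R mat_power (F c p) (K - 1))" l m
    unfolding l_def m_def by (rule F_structure_projection_field[OF assms(1)])
  have integrable: "integrable_distribution M \<A> (distribution_of m) \<longleftrightarrow> involutive"
    using integrable_imp_involutive involutive_imp_integrable by blast
  have "vanishes_on \<A> (nijenhuis l (apply_tensor m (complexify_field X)) (apply_tensor m (complexify_field Y)))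
      \<longleftrightarrow> vanishes_on \<A> (apply_tensor l (lie_bracket
            (apply_tensor m (complexify_field X)) (apply_tensor m (complexify_field Y))))"
    if "vector_field \<A> X \<and> vector_field \<A> Y" for X Y
    unfolding vanishes_on_def using nijenhuis_m_fields[of X Y] that by (simp add: apply_tensor_def[of l])
  then show ?thesis unfolding integrable involutive_iff_brackets by blast
qed

end
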